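(* Let $(W,G)$ be an admissible Landau–Ginzburg pair and let $\{L_k\}_{k\ge -1}$ be the differential operators attached to $(W,G)$ (defined in the context). They satisfy the relations $$[L_m,L_n]=(m-n)\,L_{m+n}\qquad (m,n\ge -1).$$
   Context: **Admissible LG pairs.** $W:\mathbb{C}^n\to\mathbb{C}$ is a non-degenerate quasi-homogeneous polynomial: it has an isolated critical point only at the origin, and there are uniquely determined weights $q_i\in(0,\tfrac12]\cap\mathbb{Q}$ of the variables $x_i$ making $W$ homogeneous of weight $1$. Let $G_W=\{(\lambda_1,\dots,\lambda_n)\in(\mathbb{C}^* )^n: W(\lambda_1x_1,\dots,\lambda_nx_n)=W(x_1,\dots,x_n)\}$ and $J=J_W=(e^{2\pi\sqrt{-1}q_1},\dots,e^{2\pi\sqrt{-1}q_n})\in G_W$. A subgroup $G\le G_W$ is admissible if $J_W\in G$; then $(W,G)$ is called an admissible LG pair. **State space.** For $\gamma=(e^{2\pi\sqrt{-1}\theta_1},\dots,e^{2\pi\sqrt{-1}\theta_n})\in G$ with $\theta_i\in[0,1)\cap\mathbb{Q}$, set $\iota_\gamma=\sum_{i=1}^n(\theta_i-q_i)$; let $\mathrm{Fix}(\gamma)\subset\mathbb{C}^n$ be the fixed locus, $N_\gamma=\dim_{\mathbb{C}}\mathrm{Fix}(\gamma)$, $W_\gamma=W|_{\mathrm{Fix}(\gamma)}$, and $d\mathbf{x}_\gamma$ the standard top form on $\mathrm{Fix}(\gamma)$. With $\mathrm{Jac}(W_\gamma)$ the Jacobian algebra (polynomial ring modulo the partial derivatives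 of $W_\gamma$), put $\mathcal{H}_\gamma=(\mathrm{Jac}(W_\gamma)\cdot d\mathbf{x}_\gamma)^G$, where $(\lambda_1,\dots,\lambda_n)\in G$ acts on both $x_i$ and $dx_i$ by multiplication by $\lambda_i$, and $\mathcal{H}_{W,G}=\bigoplus_{\gamma\in G}\mathcal{H}_\gamma$. Elements are written $\alpha|\gamma\rangle$. For $\alpha=[\prod_{\theta_i=0}x_i^{m_i}]\,d\mathbf{x}_\gamma$ put $\mathrm{wt}(\alpha)=\sum_{\theta_i=0}(m_i+1)q_i$. **Grading and parity.** Let $\widehat c_W=\sum_{i=1}^n(1-2q_i)$. For a homogeneous element $\phi_a=\alpha|\gamma\rangle$ set $\mu_a^+=\mathrm{wt}(\alpha)+\iota_\gamma-\widehat c_W/2$. The parity of $\phi_a$ is that of $N_\gamma$; write $N_a=N_\gamma$. **Pairing.** Fix a homogeneous basis $\{\phi_a=[f_a]\,d\mathbf{x}_{\gamma_a}|\gamma_a\rangle\}$ of $\mathcal{H}_{W,G}$, with $\phi_0=1|J\rangle$. The pairing is $\eta_{ab}=(\phi_a,\phi_b)=0$ if $\gamma_a\ne\gamma_b^{-1}$, and $\eta_{ab}=\mathrm{Res}_{W_{\gamma_a}}(f_af_b\cdot d\mathbf{x}_{\gamma_a})$ if $\gamma_a=\gamma_b^{-1}$, where $\mathrm{Res}_{W_{\gamma_a}}$ is the Grothendieck residue pairing on $\mathrm{Jac}(W_{\gamma_a})$. $(\eta^{ab})$ is the inverse matrix of $(\eta_{ab})$. **The operators.** Pochhammer symbol: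 $(\ell)_0=1$, $(\ell)_n=\ell(\ell+1)\cdots(\ell+n-1)$ for $n\ge1$. To each $\phi_az^m$, $m\ge0$, assign a variable $t_m^a$ whose parity is that of $\phi_a$ (with the usual signs when odd quantities are interchanged); $\hbar$ is a formal parameter. For each integer $k\ge-1$, with summation over repeated basis indices $a,b$, $$\begin{aligned}L_k:=&-\Big(\tfrac{3-\widehat c_W}{2}\Big)_{k+1}\frac{\partial}{\partial t^0_{k+1}}+\sum_{m=0}^\infty\Big(\mu_a^++m+\tfrac12\Big)_{k+1}t^a_m\frac{\partial}{\partial t^a_{m+k}}\\&+\frac{\hbar^2}{2}\sum_{m=-k}^{-1}(-1)^m\Big(\mu_a^++m+\tfrac12\Big)_{k+1}\eta^{ab}\frac{\partial}{\partial t^a_{-m-1}}\frac{\partial}{\partial t^b_{m+k}}\\&+\frac{1}{2\hbar^2}\delta_{-1,k}\,\eta_{ab}t_0^at_0^b-\frac{\delta_{0,k}}4\sum_a(-1)^{N_a}\big(\mu_a^+-\tfrac12\big)\big(\mu_a^++\tfrac12\big),\end{aligned}$$ where terms with a negative lower index $m+k$ are omitted.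
   Formalization: In the second-order term μ_b replaces μ_a (as printed, the relations fail for W=x³); on odd sectors the residue pairing is multiplied by the sign exp(πi·wt(φ_b)) to be graded symmetric, and η^{ab} is the inverse contracted over first indices, since otherwise the odd constant in L_0 is missed. *)

theory Defs
  imports
    "HOL-Analysis.Analysis"
    "HOL-Computational_Algebra.Formal_Laurent_Series"
    "HOL-Library.Poly_Mapping"
    "HOL-Combinatorics.Permutations"
    "HOL-Algebra.Group"
begin

section \<open>Polynomials in the variables indexed by a finite type\<close>

type_synonym 'n mpoly = "('n \<Rightarrow>\<^sub>0 nat) \<Rightarrow>\<^sub>0 complex"

abbreviation coeff_at :: "'n mpoly \<Rightarrow> ('n \<Rightarrow>\<^sub>0 nat) \<Rightarrow> complex" where
  "coeff_at \<equiv> Poly_Mapping.lookup"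

abbreviation expo :: "('v \<Rightarrow>\<^sub>0 nat) \<Rightarrow> 'v \<Rightarrow> nat" where
  "expo \<equiv> Poly_Mapping.lookup"

abbreviation const_poly :: "complex \<Rightarrow> 'n mpoly" where
  "const_poly \<equiv> Poly_Mapping.single 0"

definition eval_poly :: "'n::finite mpoly \<Rightarrow> complex ^ 'n \<Rightarrow> complex" where
  "eval_poly p x = (\<Sum>e\<in>Poly_Mapping.keys p. coeff_at p e * (\<Prod>i\<in>UNIV. x $ i ^ expo e i))"

(* p(lambda_1 x_1, ..., lambda_n x_n) *)
definition rescale :: "complex ^ 'n \<Rightarrow> 'n::finite mpoly \<Rightarrow> 'n mpoly" where
  "rescale l p = (\<Sum>e\<in>Poly_Mapping.keys p.
     Poly_Mapping.single e (coeff_at p e * (\<Prod>i\<in>UNIV. l $ i ^ expo e i)))"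

definition partial_deriv :: "'n \<Rightarrow> 'n mpoly \<Rightarrow> 'n mpoly" where
  "partial_deriv i p = (\<Sum>e\<in>Poly_Mapping.keys p.
     Poly_Mapping.single (e - Poly_Mapping.single i 1) (of_nat (expo e i) * coeff_at p e))"

(* The polynomial ring in the variables x_i with i in F. *)
definition polys_in :: "'n set \<Rightarrow> 'n mpoly set" where
  "polys_in F = {p. \<forall>e\<in>Poly_Mapping.keys p. Poly_Mapping.keys e \<subseteq> F}"

(* Restriction of p to the coordinate subspace where x_i = 0 for all i outside F. *)
definition restrict_poly :: "'n set \<Rightarrow> 'n mpoly \<Rightarrow> 'n mpoly" where
  "restrict_poly F p = (\<Sum>e\<in>{e \<in> Poly_Mapping.keys p. Poly_Mapping.keys e \<subseteq> F}.
     Poly_Mapping.single e (coeff_at p e))"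

definition quasi_homogeneous :: "('n::finite \<Rightarrow> real) \<Rightarrow> real \<Rightarrow> 'n mpoly \<Rightarrow> bool" where
  "quasi_homogeneous q w p \<longleftrightarrow>
     (\<forall>e\<in>Poly_Mapping.keys p. (\<Sum>i\<in>UNIV. real (expo e i) * q i) = w)"


section \<open>Admissible Landau-Ginzburg pairs\<close>

definition weight_system :: "'n::finite mpoly \<Rightarrow> ('n \<Rightarrow> real) \<Rightarrow> bool" where
  "weight_system W q \<longleftrightarrow>
     (\<forall>i. q i \<in> \<rat> \<and> 0 < q i \<and> q i \<le> 1 / 2) \<and> quasi_homogeneous q 1 W"

definition nondegenerate :: "'n::finite mpoly \<Rightarrow> bool" where
  "nondegenerate W \<longleftrightarrow>
     (\<exists>!q. weight_system W q) \<and>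
     (\<forall>x. (\<forall>i. eval_poly (partial_deriv i W) x = 0) \<longleftrightarrow> x = 0)"

definition weights :: "'n::finite mpoly \<Rightarrow> 'n \<Rightarrow> real" where
  "weights W = (THE q. weight_system W q)"

definition diagonal_symmetries :: "'n::finite mpoly \<Rightarrow> (complex ^ 'n) monoid" where
  "diagonal_symmetries W =
     \<lparr>carrier = {l. (\<forall>i. l $ i \<noteq> 0) \<and> rescale l W = W}, mult = (*), one = 1\<rparr>"

definition exponential_element :: "'n::finite mpoly \<Rightarrow> complex ^ 'n" where
  "exponential_element W = (\<chi> i. exp (2 * of_real pi * \<i> * of_real (weights W i)))"

definition admissible_LG_pair :: "'n::finite mpoly \<Rightarrow> (complex ^ 'n) set \<Rightarrow> bool" where
  "admissible_LG_pair W G \<longleftrightarrow>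
     nondegenerate W \<and> subgroup G (diagonal_symmetries W) \<and> exponential_element W \<in> G"


section \<open>The state space\<close>

definition theta :: "complex ^ 'n \<Rightarrow> 'n \<Rightarrow> real" where
  "theta g i = Arg2pi (g $ i) / (2 * pi)"

(* For g = (exp(2 pi i theta_1), ..., exp(2 pi i theta_n)) the locus Fix(g) is the coordinate
   subspace spanned by the directions with theta_i = 0. *)
definition fixed_vars :: "complex ^ 'n \<Rightarrow> 'n set" where
  "fixed_vars g = {i. theta g i = 0}"

definition fix_dim :: "complex ^ 'n::finite \<Rightarrow> nat" where
  "fix_dim g = card (fixed_vars g)"

definition iota :: "'n::finite mpoly \<Rightarrow> complex ^ 'n \<Rightarrow> real" where
  "iota W g = (\<Sum>i\<in>UNIV. theta g i - weights W i)"

definition jacobian_ideal :: "'n::finite mpoly \<Rightarrow> 'n set \<Rightarrow> 'n mpoly set" where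
  "jacobian_ideal W F =
     {\<Sum>i\<in>F. h i * partial_deriv i (restrict_poly F W) | h. \<forall>i\<in>F. h i \<in> polys_in F}"

(* The class [p] in the Jacobian algebra of W restricted to the variables in F. *)
definition jac_class :: "'n::finite mpoly \<Rightarrow> 'n set \<Rightarrow> 'n mpoly \<Rightarrow> 'n mpoly set" where
  "jac_class W F p = {p' \<in> polys_in F. p' - p \<in> jacobian_ideal W F}"

(* The action of l on p dx, for dx the product of the dx_i with i in F. *)
definition act_form :: "complex ^ 'n \<Rightarrow> 'n set \<Rightarrow> 'n::finite mpoly \<Rightarrow> 'n mpoly" where
  "act_form l F p = const_poly (\<Prod>i\<in>F. l $ i) * rescale l p"

definition sector :: "'n::finite mpoly \<Rightarrow> (complex ^ 'n) set \<Rightarrow> complex ^ 'n \<Rightarrow> 'n mpoly set set" where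
  "sector W G g = {jac_class W (fixed_vars g) p | p. p \<in> polys_in (fixed_vars g) \<and>
     (\<forall>l\<in>G. jac_class W (fixed_vars g) (act_form l (fixed_vars g) p)
            = jac_class W (fixed_vars g) p)}"

(* The elements phi_a = [f a] dx |gam a>, a < r, are homogeneous and form a basis of the direct
   sum of the sectors: every element of a sector is a unique combination of those phi_a which lie
   in that sector.  In particular no [f a] is zero. *)
definition homogeneous_basis ::
  "'n::finite mpoly \<Rightarrow> (complex ^ 'n) set \<Rightarrow> nat \<Rightarrow> (nat \<Rightarrow> complex ^ 'n) \<Rightarrow> (nat \<Rightarrow> 'n mpoly) \<Rightarrow> bool" where
  "homogeneous_basis W G r gam f \<longleftrightarrow>
     (\<forall>a<r. gam a \<in> G \<and> f a \<in> polys_in (fixed_vars (gam a)) \<and>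
        (\<exists>w. quasi_homogeneous (weights W) w (f a)) \<and>
        jac_class W (fixed_vars (gam a)) (f a) \<in> sector W G (gam a)) \<and>
     (\<forall>g\<in>G. \<forall>\<alpha>\<in>sector W G g. \<exists>!c :: nat \<Rightarrow> complex.
        (\<forall>a. c a \<noteq> 0 \<longrightarrow> a < r \<and> gam a = g) \<and>
        jac_class W (fixed_vars g) (\<Sum>a<r. const_poly (c a) * f a) = \<alpha>)"

definition wt :: "'n::finite mpoly \<Rightarrow> complex ^ 'n \<Rightarrow> 'n mpoly \<Rightarrow> real" where
  "wt W g p = (THE w. \<forall>e\<in>Poly_Mapping.keys p.
     w = (\<Sum>i\<in>fixed_vars g. (real (expo e i) + 1) * weights W i))"

definition central_charge :: "'n::finite mpoly \<Rightarrow> real" where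
  "central_charge W = (\<Sum>i\<in>UNIV. 1 - 2 * weights W i)"

definition mu_plus :: "'n::finite mpoly \<Rightarrow> complex ^ 'n \<Rightarrow> 'n mpoly \<Rightarrow> real" where
  "mu_plus W g p = wt W g p + iota W g - central_charge W / 2"


section \<open>The residue pairing\<close>

(* The Grothendieck residue of p dx / (d_1 W, ..., d_N W) at the origin, in its algebraic form:
   if x_i^(M i) is the sum over j of c i j * d_j W, then the transformation law for residues gives
     Res (p dx / (d_1 W, ..., d_N W)) = Res (det c * p dx / (x_1^(M 1), ..., x_N^(M N))),
   the coefficient of the product of the x_i^(M i - 1) in det c * p.  The value does not depend on
   the choice of M and c; passing to homogeneous components, c may be taken quasi-homogeneous. *)
definition residue_presentation ::
  "'n::finite mpoly \<Rightarrow> 'n set \<Rightarrow> ('n \<Rightarrow> nat) \<Rightarrow> ('n \<Rightarrow> 'n \<Rightarrow> 'n mpoly) \<Rightarrow> bool" where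
  "residue_presentation W F M c \<longleftrightarrow>
     (\<forall>i\<in>F. 0 < M i \<and>
        Poly_Mapping.single (Poly_Mapping.single i (M i)) 1
          = (\<Sum>j\<in>F. c i j * partial_deriv j (restrict_poly F W))) \<and>
     (\<forall>i\<in>F. \<forall>j\<in>F. c i j \<in> polys_in F \<and>
        quasi_homogeneous (weights W) (real (M i) * weights W i - (1 - weights W j)) (c i j))"

definition grothendieck_residue :: "'n::finite mpoly \<Rightarrow> 'n set \<Rightarrow> 'n mpoly \<Rightarrow> complex" where
  "grothendieck_residue W F p =
     (if \<exists>M c. residue_presentation W F M c
      then case (SOME Mc. residue_presentation W F (fst Mc) (snd Mc)) of (M, c) \<Rightarrow>
        coeff_at ((\<Sum>s | s permutes F. of_int (sign s) * (\<Prod>i\<in>F. c i (s i))) * p)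
          (\<Sum>i\<in>F. Poly_Mapping.single i (M i - 1))
      else 0)"

(* The bilinear form Res(f_a f_b) is symmetric, while the pairing has to be symmetric in the graded
   sense, i.e. antisymmetric on the classes of odd parity: otherwise the sum of eta_ab t^a t^b
   over odd a, b is zero.  So in odd sectors f_b dx is first moved by the automorphism
   (exp(pi i q_1), ..., exp(pi i q_n)), which takes W to -W, as in Fan-Jarvis-Ruan theory.  It
   multiplies f_b dx by exp(pi i wt(phi_b)); this is a sign since wt(phi_b) is an integer by
   invariance under J, and it changes under exchange of a and b because the weights add up to the
   odd number N.  In even sectors the pairing is the residue itself. *)
definition eta ::
  "'n::finite mpoly \<Rightarrow> (nat \<Rightarrow> complex ^ 'n) \<Rightarrow> (nat \<Rightarrow> 'n mpoly) \<Rightarrow> nat \<Rightarrow> nat \<Rightarrow> complex" where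
  "eta W gam f a b =
     (if gam a * gam b = 1
      then (if odd (fix_dim (gam a)) then exp (of_real pi * \<i> * of_real (wt W (gam b) (f b))) else 1)
           * grothendieck_residue W (fixed_vars (gam a)) (f a * f b)
      else 0)"

(* E = (eta^ab).  The contraction is over the first index of both matrices.  On even classes eta is
   symmetric and this is the ordinary inverse matrix; on odd ones the order of the indices is a
   sign, and the opposite order is not compatible with the order of the odd derivatives in
   eta^ab d/dt^a d/dt^b. *)
definition inverse_pairing :: "nat \<Rightarrow> (nat \<Rightarrow> nat \<Rightarrow> complex) \<Rightarrow> (nat \<Rightarrow> nat \<Rightarrow> complex) \<Rightarrow> bool" where
  "inverse_pairing r h E \<longleftrightarrow>
     (\<forall>b<r. \<forall>c<r. (\<Sum>a<r. E a b * h a c) = (if b = c then 1 else 0))"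


section \<open>Power series in even and odd variables\<close>

(* The variable t^a_m is the pair (a, m).  A series is the family of its coefficients, Laurent
   series in hbar, with respect to the monomials in which the odd variables are written in
   increasing order. *)
type_synonym tvar = "nat \<times> nat"
type_synonym tseries = "(tvar \<Rightarrow>\<^sub>0 nat) \<Rightarrow> complex fls"

abbreviation hbar :: "complex fls" where
  "hbar \<equiv> fls_X"

definition tvar_less :: "tvar \<Rightarrow> tvar \<Rightarrow> bool" where
  "tvar_less u v \<longleftrightarrow> snd u < snd v \<or> snd u = snd v \<and> fst u < fst v"

definition super_monomial :: "nat \<Rightarrow> (nat \<Rightarrow> bool) \<Rightarrow> (tvar \<Rightarrow>\<^sub>0 nat) \<Rightarrow> bool" where
  "super_monomial r od e \<longleftrightarrow>
     (\<forall>v\<in>Poly_Mapping.keys e. fst v < r \<and> (od (fst v) \<longrightarrow> expo e v = 1))"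

definition super_series :: "nat \<Rightarrow> (nat \<Rightarrow> bool) \<Rightarrow> tseries set" where
  "super_series r od = {S. \<forall>e. S e \<noteq> 0 \<longrightarrow> super_monomial r od e}"

(* The sign from moving v past the odd variables of e that precede it. *)
definition koszul_sign :: "(nat \<Rightarrow> bool) \<Rightarrow> tvar \<Rightarrow> (tvar \<Rightarrow>\<^sub>0 nat) \<Rightarrow> complex fls" where
  "koszul_sign od v e =
     (if od (fst v) then (- 1) ^ card {u \<in> Poly_Mapping.keys e. od (fst u) \<and> tvar_less u v} else 1)"

(* Multiplication by t_v from the left. *)
definition t_mult :: "nat \<Rightarrow> (nat \<Rightarrow> bool) \<Rightarrow> tvar \<Rightarrow> tseries \<Rightarrow> tseries" where
  "t_mult r od v S e =
     (if super_monomial r od e \<and> v \<in> Poly_Mapping.keys e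
      then koszul_sign od v e * S (e - Poly_Mapping.single v 1) else 0)"

(* The left derivative with respect to t_v. *)
definition t_deriv :: "(nat \<Rightarrow> bool) \<Rightarrow> tvar \<Rightarrow> tseries \<Rightarrow> tseries" where
  "t_deriv od v S e =
     koszul_sign od v e * of_nat (expo e v + 1) * S (e + Poly_Mapping.single v 1)"


section \<open>The Virasoro operators\<close>

(* The factor (mu + m + 1/2)_(k+1) in the terms quadratic in the derivatives is the one for the
   index b of the derivative with respect to t^b_(m+k), as in the terms t^a_m d/dt^a_(m+k), which
   they continue to negative m.  Since eta^ab = 0 unless mu_a = - mu_b, taking mu_a there instead
   gives a different operator, and [L_1, L_2] = - L_3 then fails already for W = x^3.
   The sum over all m is finite at each monomial. *)
definition virasoro ::
  "'n::finite mpoly \<Rightarrow> nat \<Rightarrow> (nat \<Rightarrow> complex ^ 'n) \<Rightarrow> (nat \<Rightarrow> 'n mpoly) \<Rightarrow> (nat \<Rightarrow> nat \<Rightarrow> complex)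
     \<Rightarrow> int \<Rightarrow> tseries \<Rightarrow> tseries" where
  "virasoro W r gam f E k S = (\<lambda>e.
     let mu = (\<lambda>a. mu_plus W (gam a) (f a));
         N = (\<lambda>a. fix_dim (gam a));
         od = (\<lambda>a. odd (N a));
         t = (\<lambda>a m. t_mult r od (a, m));
         D = (\<lambda>a m. t_deriv od (a, m));
         poch = (\<lambda>x. pochhammer x (nat (k + 1)));
         C = (\<lambda>x. fls_const (complex_of_real x))
     in - C (poch ((3 - central_charge W) / 2)) * D 0 (nat (k + 1)) S e
        + Sum_any (\<lambda>m. if 0 \<le> int m + k
            then \<Sum>a<r. C (poch (mu a + real m + 1 / 2)) * t a m (D a (nat (int m + k)) S) e
            else 0)
        + hbar ^ 2 / 2 * (\<Sum>m\<in>{- k..- 1}. \<Sum>a<r. \<Sum>b<r.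
            (- 1) powi m * C (poch (mu b + of_int m + 1 / 2)) * fls_const (E a b)
              * D a (nat (- m - 1)) (D b (nat (m + k)) S) e)
        + (if k = - 1
           then 1 / (2 * hbar ^ 2)
             * (\<Sum>a<r. \<Sum>b<r. fls_const (eta W gam f a b) * t a 0 (t b 0 S) e)
           else 0)
        - (if k = 0
           then C (1 / 4 * (\<Sum>a<r. (- 1) ^ N a * (mu a - 1 / 2) * (mu a + 1 / 2))) * S e
           else 0))"

end

(* Write J(a, j) = t^a_j - [(a, j) = (0, 1)] for j >= 0 and
   J(a, j) = hbar^2 (-1)^j sum_b eta^(ba) d/dt^b_(-1-j) for j < 0.  The shift of t^0_1 absorbs the
   linear term of L_k, because mu_0^+ = - c_W / 2, and then L_k is quadratic in the J(a, j), with
     [L_k, J(a, j)] = (mu_a + j - k + 1/2)_(k+1) J(a, j - k)     for all integers j,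
   by the graded symmetry of eta and mu_a + mu_b = 0 whenever eta_ab is nonzero.  The Pochhammer
   symbols satisfy (x+m)_(n+1) (x)_(m+1) - (x+n)_(m+1) (x)_(n+1) = (m-n) (x)_(m+n+1), so that
   the defect [L_m, L_n] - (m-n) L_(m+n) commutes with all J(a, j), hence with all t_v and d/dt_v.
   As each of its coefficients involves only finitely many coefficients of the series it acts on,
   it is a scalar, read off from the constant term of its value at 1.  The only case in which this
   is not obviously 0 is {m, n} = {1, -1}, where the contraction of eta^ab with eta_ab gives twice
   the constant in L_0. *)

theory Submission
  imports Defs
begin


section \<open>Supercommuting variables and derivatives\<close>

text \<open>Multiplying out two of the operators would produce double contractions and reorderings
  of doubly infinite sums. Testing against generators needs single contractions only: a quadratic
  term commuted with a generator is linear, and the one double contraction left is the constant term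
  of a second derivative. Three facts make this rigorous for infinite series. At a monomial e,
  multiplication by t^a_m gives zero once m exceeds all levels in e, so the infinite sum may be cut
  off there, with one cutoff for both orders of a commutator. Row-finiteness replaces continuity:
  vanishing on all monomials implies vanishing on a series only because each output coefficient
  reads finitely many input coefficients. And J fixes only the origin, so the shifted variable is
  even and subtracting 1 from it disturbs no sign. The geometry enters through the pairing alone:
  homogeneity of the residue gives mu_a + mu_b = 0, and integrality of weights, forced by invariance
  under J, gives graded symmetry.\<close>

lemma keys_plus_single:
  "Poly_Mapping.keys (e + Poly_Mapping.single v (Suc 0) :: 'v \<Rightarrow>\<^sub>0 nat) = insert v (Poly_Mapping.keys e)"
  by (auto simp: in_keys_iff lookup_add lookup_single when_def split: if_splits)

lemma keys_minus_single:
  "Poly_Mapping.keys (e - Poly_Mapping.single v (Suc 0) :: 'v \<Rightarrow>\<^sub>0 nat) =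
     (if expo e v = 1 then Poly_Mapping.keys e - {v} else Poly_Mapping.keys e)"
  by (auto simp: in_keys_iff lookup_minus lookup_single when_def split: if_splits)

lemma minus_single_plus_single:
  "v \<in> Poly_Mapping.keys e \<Longrightarrow> e - Poly_Mapping.single v (Suc 0) + Poly_Mapping.single v (Suc 0) = (e :: 'v \<Rightarrow>\<^sub>0 nat)"
  by (rule poly_mapping_eqI) (auto simp: in_keys_iff lookup_minus lookup_add lookup_single when_def)

lemma minus_single_commute_plus_single:
  "u \<noteq> v \<Longrightarrow> e + Poly_Mapping.single u (Suc 0) - Poly_Mapping.single v (Suc 0) =
    (e - Poly_Mapping.single v (Suc 0) + Poly_Mapping.single u (Suc 0) :: 'v \<Rightarrow>\<^sub>0 nat)"
  by (rule poly_mapping_eqI) (auto simp: in_keys_iff lookup_minus lookup_add lookup_single when_def)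

lemma minus_single_swap:
  "e - Poly_Mapping.single u (Suc 0) - Poly_Mapping.single v (Suc 0) =
    (e - Poly_Mapping.single v (Suc 0) - Poly_Mapping.single u (Suc 0) :: 'v \<Rightarrow>\<^sub>0 nat)"
  by (rule poly_mapping_eqI) (simp add: lookup_minus)

lemma tvar_less_asym: "tvar_less u v \<Longrightarrow> \<not> tvar_less v u"
  by (auto simp: tvar_less_def)

lemma tvar_less_linear: "u \<noteq> v \<Longrightarrow> tvar_less u v \<or> tvar_less v u"
  by (cases u; cases v) (auto simp: tvar_less_def)

section \<open>Koszul signs under insertion and removal of a variable\<close>

lemma koszul_sign_even: "\<not> od (fst v) \<Longrightarrow> koszul_sign od v e = 1"
  by (simp add: koszul_sign_def)

lemma koszul_sign_sqr: "koszul_sign od v e * koszul_sign od v e = 1"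
  by (simp add: koszul_sign_def minus_one_power_iff)

text \<open>The factor by which the Koszul sign of v changes when u is inserted into or removed from
  a monomial.\<close>

definition crossing_sign :: "(nat \<Rightarrow> bool) \<Rightarrow> tvar \<Rightarrow> tvar \<Rightarrow> complex fls" where
  "crossing_sign od u v = (if od (fst u) \<and> od (fst v) \<and> tvar_less u v then - 1 else 1)"

definition super_sign :: "(nat \<Rightarrow> bool) \<Rightarrow> nat \<Rightarrow> nat \<Rightarrow> complex fls" where
  "super_sign od a b = (if od a \<and> od b then - 1 else 1)"

text \<open>Of two distinct variables exactly one precedes the other, so for odd ones exactly one of
  the two crossings costs a sign. Every exchange sign of distinct variables below comes from
  this.\<close>

lemma crossing_sign_swap:
  "u \<noteq> v \<Longrightarrow> crossing_sign od u v = super_sign od (fst u) (fst v) * crossing_sign od v u"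
  using tvar_less_linear[of u v] tvar_less_asym[of u v]
  by (auto simp: crossing_sign_def super_sign_def)

lemma crossing_sign_sqr: "crossing_sign od u v * crossing_sign od u v = 1"
  by (auto simp: crossing_sign_def)

lemma card_odd_predecessors_insert:
  assumes "finite K" "u \<notin> K" "od (fst u)"
  shows "card {x \<in> insert u K. od (fst x) \<and> tvar_less x v} =
    (if tvar_less u v then Suc (card {x \<in> K. od (fst x) \<and> tvar_less x v})
     else card {x \<in> K. od (fst x) \<and> tvar_less x v})"
proof -
  have "{x \<in> insert u K. od (fst x) \<and> tvar_less x v} =
    (if tvar_less u v then insert u {x \<in> K. od (fst x) \<and> tvar_less x v}
     else {x \<in> K. od (fst x) \<and> tvar_less x v})"
    using assms by auto
  then show ?thesis using assms by auto
qed

lemma odd_predecessors_insert_even: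
  "\<not> od (fst u) \<Longrightarrow> {x \<in> insert u K. od (fst x) \<and> tvar_less x v} = {x \<in> K. od (fst x) \<and> tvar_less x v}"
  by auto

text \<open>The Koszul sign counts keys without multiplicity, so an odd u already present would not
  be counted again; hence the premise.\<close>

lemma koszul_sign_plus:
  assumes "od (fst u) \<longrightarrow> u \<notin> Poly_Mapping.keys e"
  shows "koszul_sign od v (e + Poly_Mapping.single u (Suc 0)) = crossing_sign od u v * koszul_sign od v e"
proof (cases "od (fst u)")
  case True
  then show ?thesis using assms
    by (simp add: koszul_sign_def keys_plus_single card_odd_predecessors_insert crossing_sign_def
        del: insert_iff)
next
  case False
  then show ?thesis
    by (simp add: koszul_sign_def keys_plus_single odd_predecessors_insert_even crossing_sign_def
        del: insert_iff)
qed

lemma koszul_sign_minus: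
  assumes "u \<in> Poly_Mapping.keys e" "od (fst u) \<longrightarrow> expo e u = 1"
  shows "koszul_sign od v (e - Poly_Mapping.single u (Suc 0)) = crossing_sign od u v * koszul_sign od v e"
proof -
  have "od (fst u) \<longrightarrow> u \<notin> Poly_Mapping.keys (e - Poly_Mapping.single u (Suc 0))"
    using assms by (simp add: keys_minus_single)
  from koszul_sign_plus[of od u "e - Poly_Mapping.single u (Suc 0)", OF this, of v] show ?thesis
    using assms by (simp add: minus_single_plus_single crossing_sign_sqr flip: mult.assoc)
qed

lemma super_monomial_plus:
  "super_monomial r od (e + Poly_Mapping.single v (Suc 0)) \<longleftrightarrow>
    super_monomial r od e \<and> fst v < r \<and> (od (fst v) \<longrightarrow> v \<notin> Poly_Mapping.keys e)"
  by (auto simp: super_monomial_def keys_plus_single lookup_add lookup_single when_def in_keys_iff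
      split: if_splits)

lemma super_monomial_minus:
  "super_monomial r od e \<Longrightarrow> super_monomial r od (e - Poly_Mapping.single v (Suc 0))"
  by (auto simp: super_monomial_def in_keys_iff lookup_minus lookup_single when_def)

lemma super_seriesD: "S \<in> super_series r od \<Longrightarrow> \<not> super_monomial r od e \<Longrightarrow> S e = 0"
  by (auto simp: super_series_def)

section \<open>Supercommutation relations of variables and derivatives\<close>

lemma t_mult_super_series: "t_mult r od v S \<in> super_series r od"
  by (auto simp: super_series_def t_mult_def)

lemma t_deriv_super_series: "S \<in> super_series r od \<Longrightarrow> t_deriv od v S \<in> super_series r od"
  unfolding super_series_def t_deriv_def
  by (auto simp: super_monomial_plus)

lemma t_mult_t_mult:
  assumes "S \<in> super_series r od"
  shows "t_mult r od u (t_mult r od v S) e =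
    super_sign od (fst u) (fst v) * t_mult r od v (t_mult r od u S) e"
proof (cases "super_monomial r od e")
  case sm: True
  show ?thesis
  proof (cases "u = v")
    case True
    have "od (fst u) \<Longrightarrow> t_mult r od u (t_mult r od u S) e = 0"
      using sm by (auto simp: t_mult_def keys_minus_single super_monomial_def)
    then show ?thesis using True by (auto simp: super_sign_def)
  next
    case neq: False
    have *: "t_mult r od u (t_mult r od v S) e =
      (if u \<in> Poly_Mapping.keys e \<and> v \<in> Poly_Mapping.keys e
       then koszul_sign od u e * koszul_sign od v e * crossing_sign od u v
         * S (e - Poly_Mapping.single u (Suc 0) - Poly_Mapping.single v (Suc 0)) else 0)"
      if "u \<noteq> v" for u v
    proof (cases "u \<in> Poly_Mapping.keys e")
      case True
      have "od (fst u) \<longrightarrow> expo e u = 1"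
        using sm True by (auto simp: super_monomial_def)
      with True that show ?thesis
        using sm super_monomial_minus[OF sm, of u]
        by (auto simp: t_mult_def keys_minus_single koszul_sign_minus)
    qed (simp add: t_mult_def)
    show ?thesis
      using neq by (simp add: * crossing_sign_swap[of u v] minus_single_swap[of e u v] mult_ac)
  qed
qed (simp add: t_mult_def)

lemma t_deriv_t_deriv:
  assumes "S \<in> super_series r od"
  shows "t_deriv od u (t_deriv od v S) e =
    super_sign od (fst u) (fst v) * t_deriv od v (t_deriv od u S) e"
proof (cases "u = v")
  case True
  \<comment> \<open>The square of an odd derivative reads a coefficient of S at a monomial
    containing u twice, where a super series is zero.\<close>
  have "od (fst u) \<Longrightarrow> t_deriv od u (t_deriv od u S) e = 0"
    using super_seriesD[OF assms]
    by (auto simp: t_deriv_def super_monomial_plus keys_plus_single)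
  then show ?thesis using True by (auto simp: super_sign_def)
next
  case neq: False
  show ?thesis
  proof (cases "super_monomial r od (e + Poly_Mapping.single u (Suc 0) + Poly_Mapping.single v (Suc 0))")
    case True
    have *: "t_deriv od u (t_deriv od v S) e =
       koszul_sign od u e * koszul_sign od v e * crossing_sign od u v
         * of_nat (expo e u + 1) * of_nat (expo e v + 1)
         * S (e + Poly_Mapping.single u (Suc 0) + Poly_Mapping.single v (Suc 0))"
      if "u \<noteq> v" "od (fst u) \<longrightarrow> u \<notin> Poly_Mapping.keys e" for u v
      using that by (simp add: t_deriv_def koszul_sign_plus lookup_add lookup_single)
    have "od (fst u) \<longrightarrow> u \<notin> Poly_Mapping.keys e" "od (fst v) \<longrightarrow> v \<notin> Poly_Mapping.keys e"
      using True by (auto simp: super_monomial_plus keys_plus_single)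
    then show ?thesis
      using neq by (simp add: * crossing_sign_swap[of u v] add_ac mult_ac)
  next
    case False
    then show ?thesis
      using super_seriesD[OF assms False] by (simp add: t_deriv_def add_ac)
  qed
qed

text \<open>For u = v even this is the Leibniz count n + 1 = 1 + n of exponents. For u = v odd
  exactly one of the two orders survives at e, according to whether e contains u. For distinct
  variables only crossing signs are compared.\<close>

lemma t_deriv_t_mult:
  assumes "S \<in> super_series r od" "fst u < r"
  shows "t_deriv od u (t_mult r od v S) e =
    (if u = v then S e else 0) + super_sign od (fst u) (fst v) * t_mult r od v (t_deriv od u S) e"
proof (cases "super_monomial r od e")
  case sm: True
  show ?thesis
  proof (cases "u = v")
    case True
    show ?thesis
    proof (cases "od (fst u)")
      case odd: True
      show ?thesis
      proof (cases "u \<in> Poly_Mapping.keys e")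
        case True
        have "expo e u = 1" using sm True odd by (auto simp: super_monomial_def)
        with True odd sm \<open>u = v\<close> show ?thesis
          by (auto simp: t_deriv_def t_mult_def super_monomial_plus lookup_minus super_sign_def
             koszul_sign_minus minus_single_plus_single koszul_sign_sqr crossing_sign_sqr mult_ac
             crossing_sign_def tvar_less_def
             simp flip: mult.assoc)
      next
        case False
        with odd sm \<open>u = v\<close> \<open>fst u < r\<close> show ?thesis
          by (auto simp: t_deriv_def t_mult_def super_monomial_plus super_sign_def in_keys_iff
             koszul_sign_plus keys_plus_single crossing_sign_def tvar_less_def
             koszul_sign_sqr simp flip: mult.assoc)
      qed
    next
      case False
      with sm \<open>u = v\<close> \<open>fst u < r\<close> show ?thesis
        by (auto simp: t_deriv_def t_mult_def super_monomial_plus super_sign_def in_keys_iff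
             koszul_sign_even keys_plus_single lookup_minus minus_single_plus_single distrib_right)
    qed
  next
    case neq: False
    show ?thesis
    proof (cases "v \<in> Poly_Mapping.keys e")
      case v: True
      have ov: "od (fst v) \<longrightarrow> expo e v = 1" using sm v by (auto simp: super_monomial_def)
      show ?thesis
      proof (cases "od (fst u) \<longrightarrow> u \<notin> Poly_Mapping.keys e")
        case True
        have "crossing_sign od u v = super_sign od (fst u) (fst v) * crossing_sign od v u"
          by (rule crossing_sign_swap[OF neq])
        then show ?thesis
          using neq v ov True sm \<open>fst u < r\<close>
          by (auto simp: t_deriv_def t_mult_def super_monomial_plus keys_plus_single koszul_sign_plus
             koszul_sign_minus minus_single_commute_plus_single lookup_minus lookup_single mult_ac)
      next
        case False
        \<comment> \<open>An odd u is already in e, and a second copy leaves the super monomials, so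
          both sides vanish.\<close>
        then have "\<not> super_monomial r od (e + Poly_Mapping.single u (Suc 0))"
          "\<not> super_monomial r od (e - Poly_Mapping.single v (Suc 0) + Poly_Mapping.single u (Suc 0))"
          using neq by (auto simp: super_monomial_plus keys_minus_single)
        then show ?thesis using neq super_seriesD[OF assms(1)]
          by (auto simp: t_deriv_def t_mult_def)
      qed
    next
      case False
      then show ?thesis using neq
        by (auto simp: t_deriv_def t_mult_def keys_plus_single)
    qed
  qed
next
  case False
  then show ?thesis using super_seriesD[OF assms(1) False]
    by (auto simp: t_deriv_def t_mult_def super_monomial_plus)
qed


section \<open>Operators with finitely supported rows\<close>

text \<open>Row-finiteness stands in for continuity. It is stable under composition and lets
  operators be tested on monomials without any topology on series.\<close>

definition local_functional :: "(tseries \<Rightarrow> complex fls) \<Rightarrow> bool" where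
  "local_functional \<phi> \<longleftrightarrow> (\<exists>F p. finite F \<and> (\<forall>S. \<phi> S = (\<Sum>e\<in>F. p e * S e)))"

abbreviation local_operator :: "(tseries \<Rightarrow> tseries) \<Rightarrow> bool" where
  "local_operator P \<equiv> \<forall>e. local_functional (\<lambda>S. P S e)"

abbreviation tmonom :: "(tvar \<Rightarrow>\<^sub>0 nat) \<Rightarrow> tseries" where
  "tmonom e \<equiv> (\<lambda>e'. if e' = e then 1 else 0)"

lemma local_functional_eval: "local_functional (\<lambda>S. c * S e)"
  unfolding local_functional_def
  by (rule exI[of _ "{e}"], rule exI[of _ "\<lambda>_. c"]) simp

lemma local_functional_zero: "local_functional (\<lambda>S. 0)"
  using local_functional_eval[of 0] by simp

lemma local_functional_scale: "local_functional \<phi> \<Longrightarrow> local_functional (\<lambda>S. c * \<phi> S)"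
  unfolding local_functional_def
proof (elim exE conjE)
  fix F p assume "finite F" "\<forall>S. \<phi> S = (\<Sum>e\<in>F. p e * S e)"
  then show "\<exists>F p. finite F \<and> (\<forall>S. c * \<phi> S = (\<Sum>e\<in>F. p e * S e))"
    by (intro exI[of _ F] exI[of _ "\<lambda>e. c * p e"]) (simp add: sum_distrib_left mult.assoc)
qed

lemma local_functional_add:
  assumes "local_functional \<phi>" "local_functional \<psi>"
  shows "local_functional (\<lambda>S. \<phi> S + \<psi> S)"
proof -
  obtain F p where F: "finite F" "\<And>S. \<phi> S = (\<Sum>e\<in>F. p e * S e)"
    using assms(1) by (auto simp: local_functional_def)
  obtain G q where G: "finite G" "\<And>S. \<psi> S = (\<Sum>e\<in>G. q e * S e)"
    using assms(2) by (auto simp: local_functional_def)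
  have "\<phi> S + \<psi> S = (\<Sum>e\<in>F \<union> G. ((if e \<in> F then p e else 0) + (if e \<in> G then q e else 0)) * S e)" for S
  proof -
    have "\<phi> S = (\<Sum>e\<in>F \<union> G. (if e \<in> F then p e else 0) * S e)"
      unfolding F(2) by (rule sum.mono_neutral_cong_left) (use F G in auto)
    moreover have "\<psi> S = (\<Sum>e\<in>F \<union> G. (if e \<in> G then q e else 0) * S e)"
      unfolding G(2) by (rule sum.mono_neutral_cong_left) (use F G in auto)
    ultimately show ?thesis by (simp only: distrib_right sum.distrib)
  qed
  with F(1) G(1) show ?thesis
    unfolding local_functional_def
    by (intro exI[of _ "F \<union> G"] exI[of _ "\<lambda>e. (if e \<in> F then p e else 0) + (if e \<in> G then q e else 0)"]) auto
qed

lemma local_functional_diff: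
  "local_functional \<phi> \<Longrightarrow> local_functional \<psi> \<Longrightarrow> local_functional (\<lambda>S. \<phi> S - \<psi> S)"
  using local_functional_add[of \<phi> "\<lambda>S. - 1 * \<psi> S"] local_functional_scale[of \<psi> "- 1"] by simp

lemma local_functional_sum:
  "(\<And>i. i \<in> I \<Longrightarrow> local_functional (\<phi> i)) \<Longrightarrow> local_functional (\<lambda>S. \<Sum>i\<in>I. \<phi> i S)"
  by (induction I rule: infinite_finite_induct)
    (auto intro: local_functional_zero local_functional_add)

lemma local_functional_compose:
  assumes "local_functional \<phi>" "local_operator P"
  shows "local_functional (\<lambda>S. \<phi> (P S))"
proof -
  obtain F p where F: "finite F" "\<And>S. \<phi> S = (\<Sum>e\<in>F. p e * S e)"
    using assms(1) by (auto simp: local_functional_def)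
  show ?thesis unfolding F(2)
    by (intro local_functional_sum local_functional_scale) (use assms(2) in auto)
qed

lemma local_functional_linear:
  assumes "local_functional \<phi>"
  shows "\<phi> (\<lambda>e. A e + B e) = \<phi> A + \<phi> B" "\<phi> (\<lambda>e. A e - B e) = \<phi> A - \<phi> B"
    "\<phi> (\<lambda>e. c * A e) = c * \<phi> A" "\<phi> (\<lambda>e. \<Sum>i\<in>I. R i e) = (\<Sum>i\<in>I. \<phi> (R i))"
proof -
  obtain F p where F: "finite F" "\<And>S. \<phi> S = (\<Sum>e\<in>F. p e * S e)"
    using assms(1) by (auto simp: local_functional_def)
  show "\<phi> (\<lambda>e. A e + B e) = \<phi> A + \<phi> B" "\<phi> (\<lambda>e. A e - B e) = \<phi> A - \<phi> B"
    by (simp_all add: F(2) distrib_left right_diff_distrib sum.distrib sum_subtractf)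
  show "\<phi> (\<lambda>e. c * A e) = c * \<phi> A"
    by (simp add: F(2) sum_distrib_left mult_ac)
  show "\<phi> (\<lambda>e. \<Sum>i\<in>I. R i e) = (\<Sum>i\<in>I. \<phi> (R i))"
    unfolding F(2) sum_distrib_left by (rule sum.swap)
qed

lemma local_functional_zero_arg: "local_functional \<phi> \<Longrightarrow> \<phi> (\<lambda>e. 0) = 0"
  by (auto simp: local_functional_def)

text \<open>S may have infinitely many terms, but only finitely many of its coefficients are read,
  and evaluation on a monomial returns the factor with which its coefficient enters.\<close>

lemma local_functional_eq_0:
  assumes "local_functional \<phi>" "\<And>e. S e \<noteq> 0 \<Longrightarrow> \<phi> (tmonom e) = 0"
  shows "\<phi> S = 0"
proof -
  obtain F p where F: "finite F" "\<And>S. \<phi> S = (\<Sum>e\<in>F. p e * S e)"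
    using assms(1) by (auto simp: local_functional_def)
  have "p e * S e = 0" if "e \<in> F" for e
  proof (cases "S e = 0")
    case False
    have "\<phi> (tmonom e) = (\<Sum>e'\<in>F. if e' = e then p e else 0)"
      unfolding F(2) by (rule sum.cong) auto
    also have "\<dots> = p e" using F(1) that by simp
    finally show ?thesis using assms(2)[OF False] by simp
  qed simp
  then have "\<forall>e\<in>F. p e * S e = 0" by blast
  from sum.neutral[OF this] show ?thesis by (simp only: F(2))
qed

lemma local_operator_t_mult: "local_operator (t_mult r od v)"
proof
  fix e
  show "local_functional (\<lambda>S. t_mult r od v S e)"
    by (cases "super_monomial r od e \<and> v \<in> Poly_Mapping.keys e")
      (auto simp: t_mult_def intro: local_functional_zero local_functional_eval)
qed

lemma local_operator_t_deriv: "local_operator (t_deriv od v)"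
  unfolding t_deriv_def using local_functional_eval by blast

section \<open>The super Weyl algebra with one shifted variable\<close>

locale super_weyl =
  fixes r :: nat and od :: "nat \<Rightarrow> bool"
  assumes r_pos: "0 < r" and even_0: "\<not> od 0"
begin

text \<open>One boolean family for variables and derivatives, so that a single exchange law covers
  all four kinds of pairs. The variable t^0_1 enters already shifted.\<close>

definition gen :: "bool \<Rightarrow> tvar \<Rightarrow> tseries \<Rightarrow> tseries" where
  "gen x v S e = (if x then t_mult r od v S e - (if v = (0, 1) then S e else 0) else t_deriv od v S e)"

text \<open>The scalar in the graded exchange law. From d t = 1 + s t d, with s the sign of a
  variable against itself, one gets t d = -s + s d t, which is the value in the other order.\<close>

definition contraction :: "bool \<Rightarrow> tvar \<Rightarrow> bool \<Rightarrow> tvar \<Rightarrow> complex fls" where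
  "contraction x u y v =
     (if u = v \<and> x \<noteq> y then (if x then - super_sign od (fst u) (fst u) else 1) else 0)"

lemma local_gen: "local_operator (gen x v)"
proof
  fix e
  have "local_functional (\<lambda>S. (if v = (0, 1) then 1 else 0) * S e)"
    by (rule local_functional_eval)
  then show "local_functional (\<lambda>S. gen x v S e)"
    using local_operator_t_mult local_operator_t_deriv
    by (cases x; cases "v = (0, 1)") (auto simp: gen_def intro!: local_functional_diff)
qed

lemmas gen_linear = local_functional_linear[OF local_gen[rule_format]]

lemma super_series_diff:
  "A \<in> super_series r od \<Longrightarrow> B \<in> super_series r od \<Longrightarrow> (\<lambda>e. A e - B e) \<in> super_series r od"
  unfolding super_series_def by force

lemma super_series_scale: "A \<in> super_series r od \<Longrightarrow> (\<lambda>e. c * A e) \<in> super_series r od"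
  by (auto simp: super_series_def)

lemma gen_super_series:
  assumes "S \<in> super_series r od" shows "gen x v S \<in> super_series r od"
proof (cases x)
  case False
  then have "gen x v S = t_deriv od v S" by (auto simp: gen_def)
  with t_deriv_super_series[OF assms] show ?thesis by simp
next
  case True
  then have "gen x v S = (\<lambda>e. t_mult r od v S e - (if v = (0, 1) then 1 else 0) * S e)"
    by (auto simp: gen_def)
  with super_series_diff[OF t_mult_super_series super_series_scale[OF assms]] show ?thesis by simp
qed

lemma super_sign_0: "super_sign od 0 a = 1" "super_sign od a 0 = 1"
  by (auto simp: super_sign_def even_0)

lemma super_sign_sqr: "super_sign od a b * super_sign od a b = 1"
  by (auto simp: super_sign_def)

lemma super_sign_sym: "super_sign od a b = super_sign od b a"
  by (auto simp: super_sign_def)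

lemma t_mult_minus: "t_mult r od v (\<lambda>e. A e - c * B e) e = t_mult r od v A e - c * t_mult r od v B e"
  and t_deriv_minus: "t_deriv od v (\<lambda>e. A e - c * B e) e = t_deriv od v A e - c * t_deriv od v B e"
  using local_functional_linear[OF local_operator_t_mult[rule_format]]
    local_functional_linear[OF local_operator_t_deriv[rule_format]] by auto

lemma gen_swap:
  assumes S: "S \<in> super_series r od" and "fst u < r" "fst v < r"
  shows "gen x u (gen y v S) e =
    contraction x u y v * S e + super_sign od (fst u) (fst v) * gen y v (gen x u S) e"
proof -
  define \<delta> where "\<delta> v = (if v = (0, 1) then 1 else 0 :: complex fls)" for v :: tvar
  have T: "gen True v S = (\<lambda>e. t_mult r od v S e - \<delta> v * S e)" for v S
    by (auto simp: gen_def \<delta>_def)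
  have D: "gen False v S = t_deriv od v S" for v S
    by (auto simp: gen_def)
  \<comment> \<open>The shift occurs only for class 0, which is even; it therefore passes everything
    without sign and adds nothing to the contraction.\<close>
  have \<delta>: "\<delta> u * super_sign od (fst u) (fst v) = \<delta> u" "\<delta> v * super_sign od (fst u) (fst v) = \<delta> v" for u v
    by (auto simp: \<delta>_def super_sign_0)
  note lin = t_mult_minus t_deriv_minus
  note rel = t_mult_t_mult[OF S, of u v e] t_deriv_t_deriv[OF S, of u v e]
    t_deriv_t_mult[OF S \<open>fst u < r\<close>, of v e] t_deriv_t_mult[OF S \<open>fst v < r\<close>, of u e]
  show ?thesis
  proof (cases x; cases y)
    assume xy: "x" "y"
    have TT: "gen True u (gen True v S) e = t_mult r od u (t_mult r od v S) e
        - \<delta> v * t_mult r od u S e - \<delta> u * t_mult r od v S e + \<delta> u * \<delta> v * S e" for u v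
      by (simp add: T lin right_diff_distrib mult.assoc)
    have "\<delta> u = 0 \<and> \<delta> v = 0 \<or> super_sign od (fst u) (fst v) = 1"
      using \<delta>(1)[of u v] \<delta>(2)[of v u] by auto
    then show ?thesis using rel(1) xy
      by (auto simp: TT contraction_def)
  next
    assume xy: "x" "\<not> y"
    have "super_sign od (fst u) (fst v) * gen False v (gen True u S) e
      = super_sign od (fst u) (fst v) * t_deriv od v (t_mult r od u S) e - \<delta> u * t_deriv od v S e"
      using \<delta>(1)[of u v] by (auto simp: T D lin right_diff_distrib)
    also have "super_sign od (fst u) (fst v) * t_deriv od v (t_mult r od u S) e =
      (if u = v then super_sign od (fst u) (fst u) * S e else 0) + t_mult r od u (t_deriv od v S) e"
      using super_sign_sqr[of "fst u" "fst v"] unfolding rel(4) super_sign_sym[of "fst v"]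
      by (simp add: distrib_left flip: mult.assoc)
    finally show ?thesis using xy
      by (simp add: T D contraction_def)
  next
    assume xy: "\<not> x" "y"
    have "super_sign od (fst u) (fst v) * gen True v (gen False u S) e
      = super_sign od (fst u) (fst v) * t_mult r od v (t_deriv od u S) e - \<delta> v * t_deriv od u S e"
      using \<delta>(2)[of v u] by (auto simp: T D right_diff_distrib)
    then show ?thesis using rel(3) xy
      by (simp add: T D lin contraction_def)
  next
    assume "\<not> x" "\<not> y"
    then show ?thesis using rel(2) by (simp add: D contraction_def)
  qed
qed

text \<open>Factors of equal parity have an even product, which passes w without sign: the two
  exchange signs multiply to 1, and one contraction from each factor remains.\<close>

lemma quadratic_commutator:
  assumes S: "S \<in> super_series r od" and lt: "fst u < r" "fst v < r" "fst w < r"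
    and par: "od (fst u) = od (fst v)"
  shows "gen x u (gen y v (gen z w S)) e - gen z w (gen x u (gen y v S)) e =
    contraction y v z w * gen x u S e
    + super_sign od (fst v) (fst w) * contraction x u z w * gen y v S e"
proof -
  have s: "super_sign od (fst u) (fst w) = super_sign od (fst v) (fst w)"
    using par by (simp add: super_sign_def)
  have "gen y v (gen z w S) =
    (\<lambda>e. contraction y v z w * S e + super_sign od (fst v) (fst w) * gen z w (gen y v S) e)"
    using gen_swap[OF S lt(2,3)] by blast
  then have "gen x u (gen y v (gen z w S)) e = contraction y v z w * gen x u S e
      + super_sign od (fst v) (fst w) * gen x u (gen z w (gen y v S)) e"
    by (simp add: gen_linear)
  also have "gen x u (gen z w (gen y v S)) e = contraction x u z w * gen y v S e
      + super_sign od (fst v) (fst w) * gen z w (gen x u (gen y v S)) e"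
    using gen_swap[OF gen_super_series[OF S] lt(1,3)] s by simp
  finally show ?thesis
    using super_sign_sqr[of "fst v" "fst w"]
    by (simp add: distrib_left flip: mult.assoc)
qed

text \<open>Equal parity is demanded only where the coefficient is nonzero; this is how the parity
  of the pairing and of its inverse enters.\<close>

lemma sum_quadratic_commutator:
  assumes S: "S \<in> super_series r od" and w: "fst w < r"
    and I: "\<And>i. i \<in> I \<Longrightarrow> fst (u i) < r \<and> fst (v i) < r"
    and par: "\<And>i. i \<in> I \<Longrightarrow> c i \<noteq> 0 \<Longrightarrow> od (fst (u i)) = od (fst (v i))"
    and Q: "\<And>S e. Q S e = (\<Sum>i\<in>I. c i * gen x (u i) (gen y (v i) S) e)"
  shows "Q (gen z w S) e - gen z w (Q S) e =
    (\<Sum>i\<in>I. c i * contraction y (v i) z w * gen x (u i) S e)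
    + (\<Sum>i\<in>I. c i * super_sign od (fst (v i)) (fst w) * contraction x (u i) z w * gen y (v i) S e)"
proof -
  have "Q S = (\<lambda>e. \<Sum>i\<in>I. c i * gen x (u i) (gen y (v i) S) e)"
    using Q by blast
  then have "Q (gen z w S) e - gen z w (Q S) e =
    (\<Sum>i\<in>I. c i * (gen x (u i) (gen y (v i) (gen z w S)) e - gen z w (gen x (u i) (gen y (v i) S)) e))"
    by (simp add: Q gen_linear right_diff_distrib sum_subtractf)
  also have "\<dots> = (\<Sum>i\<in>I. c i * contraction y (v i) z w * gen x (u i) S e
    + c i * super_sign od (fst (v i)) (fst w) * contraction x (u i) z w * gen y (v i) S e)"
  proof (rule sum.cong[OF refl])
    fix i assume i: "i \<in> I"
    show "c i * (gen x (u i) (gen y (v i) (gen z w S)) e - gen z w (gen x (u i) (gen y (v i) S)) e) =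
      c i * contraction y (v i) z w * gen x (u i) S e
      + c i * super_sign od (fst (v i)) (fst w) * contraction x (u i) z w * gen y (v i) S e"
      using quadratic_commutator[OF S _ _ w par[OF i], of x y z e] I[OF i]
      by (cases "c i = 0") (simp_all add: distrib_left mult.assoc)
  qed
  finally show ?thesis by (simp add: sum.distrib)
qed

end


section \<open>The graded inverse pairing and the Pochhammer cocycle\<close>

text \<open>Split (x)_(m+n+1) at x + m. For m = -1 the first piece would have negative length, and
  the recursion at the lower end of the symbol takes over.\<close>

lemma pochhammer_shift_mult:
  fixes x :: real and m n :: int
  assumes "- 1 \<le> m" "- 1 \<le> n" "- 1 \<le> m + n"
  shows "pochhammer (x + of_int m) (nat (n + 1)) * pochhammer x (nat (m + 1)) =
    (x + of_int m) * pochhammer x (nat (m + n + 1))"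
proof (cases "m = - 1")
  case True
  then have "nat (n + 1) = Suc (nat n)" "0 \<le> n" using assms by auto
  then show ?thesis using True by (simp add: pochhammer_rec)
next
  case False
  then obtain i where i: "m = int i" using assms(1) nonneg_int_cases[of m] by force
  obtain l where l: "n + 1 = int l" using assms(2) nonneg_int_cases[of "n + 1"] by force
  have "nat (m + n + 1) = i + l" "nat (m + 1) = Suc i" "nat (n + 1) = l" using i l by auto
  then show ?thesis using i by (simp add: pochhammer_product' pochhammer_Suc mult_ac)
qed

text \<open>The bracket of the Witt algebra at the level of coefficients: after the common factor is
  taken out, (x + m) - (x + n) remains.\<close>

lemma pochhammer_cocycle:
  fixes x :: real and m n :: int
  assumes "- 1 \<le> m" "- 1 \<le> n" "- 1 \<le> m + n"
  shows "pochhammer (x + of_int m) (nat (n + 1)) * pochhammer x (nat (m + 1))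
    - pochhammer (x + of_int n) (nat (m + 1)) * pochhammer x (nat (n + 1)) =
    of_int (m - n) * pochhammer x (nat (m + n + 1))"
  using pochhammer_shift_mult[of m n x] pochhammer_shift_mult[of n m x] assms
  by (simp add: algebra_simps)

lemma minus_one_powi: "(- 1 :: 'a :: field) powi k = (if even k then 1 else - 1)"
proof (cases "0 \<le> k")
  case True
  then show ?thesis by (auto simp: power_int_def minus_one_power_iff even_nat_iff)
next
  case False
  then show ?thesis by (auto simp: power_int_def minus_one_power_iff even_nat_iff)
qed

lemma sum_triple_product:
  "(\<Sum>i\<in>A \<times> B \<times> C. g i) = (\<Sum>x\<in>A. \<Sum>y\<in>B. \<Sum>z\<in>C. g (x, y, z))"
  by (simp add: sum.cartesian_product')

section \<open>Transfer of symmetry and gradings from the pairing to its inverse\<close>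

locale virasoro_data = super_weyl +
  fixes mu :: "nat \<Rightarrow> real" and \<eta> E :: "nat \<Rightarrow> nat \<Rightarrow> complex"
  assumes eta_parity: "\<And>a b. a < r \<Longrightarrow> b < r \<Longrightarrow> \<eta> a b \<noteq> 0 \<Longrightarrow> od a = od b"
    and eta_mu: "\<And>a b. a < r \<Longrightarrow> b < r \<Longrightarrow> \<eta> a b \<noteq> 0 \<Longrightarrow> mu a + mu b = 0"
    and eta_sym: "\<And>a b. a < r \<Longrightarrow> b < r \<Longrightarrow> \<eta> b a = (if od a then - 1 else 1) * \<eta> a b"
    and E_inverse: "inverse_pairing r \<eta> E"
begin

definition parity_sign :: "nat \<Rightarrow> complex" where
  "parity_sign a = (if od a then - 1 else 1)"

lemma sum_E_eta: "b < r \<Longrightarrow> c < r \<Longrightarrow> (\<Sum>a<r. E a b * \<eta> a c) = (if b = c then 1 else 0)"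
  using E_inverse by (simp add: inverse_pairing_def)

text \<open>Graded symmetry turns the given contraction over both first indices into one over
  adjacent indices, at the cost of the parity sign of c.\<close>

lemma sum_eta_E:
  assumes "c < r" "b < r"
  shows "(\<Sum>a<r. \<eta> c a * E a b) = (if b = c then parity_sign c else 0)"
proof -
  have "(\<Sum>a<r. \<eta> c a * E a b) = (\<Sum>a<r. parity_sign c * (E a b * \<eta> a c))"
  proof (rule sum.cong[OF refl])
    fix a assume "a \<in> {..<r}"
    then have "\<eta> a c = parity_sign c * \<eta> c a"
      using eta_sym[of c a] assms by (simp add: parity_sign_def)
    then show "\<eta> c a * E a b = parity_sign c * (E a b * \<eta> a c)"
      by (auto simp: parity_sign_def)
  qed
  also have "\<dots> = (if b = c then parity_sign c else 0)"
    using sum_E_eta[OF assms(2,1)] by (simp flip: sum_distrib_left)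
  finally show ?thesis .
qed

text \<open>Sandwiching \<open>\<eta>\<close> between two copies of \<open>E\<close> transfers gradings of \<open>\<eta>\<close> to \<open>E\<close>.\<close>

lemma E_grading:
  assumes pq: "\<And>x y. x < r \<Longrightarrow> y < r \<Longrightarrow> p x * \<eta> x y = q y * \<eta> x y" and "b < r" "d < r"
  shows "p d * parity_sign d * E d b = q b * E b d"
proof -
  have "(\<Sum>x<r. \<Sum>y<r. E x b * (p x * \<eta> x y) * E y d) =
      (\<Sum>x<r. E x b * p x * (\<Sum>y<r. \<eta> x y * E y d))"
    by (simp add: sum_distrib_left mult.assoc)
  also have "\<dots> = (\<Sum>x<r. if x = d then E d b * p d * parity_sign d else 0)"
    by (rule sum.cong) (use assms(3) in \<open>auto simp: sum_eta_E\<close>)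
  also have "\<dots> = p d * parity_sign d * E d b" using assms(3) by simp
  finally have 1: "(\<Sum>x<r. \<Sum>y<r. E x b * (p x * \<eta> x y) * E y d) = p d * parity_sign d * E d b" .
  have "(\<Sum>x<r. \<Sum>y<r. E x b * (p x * \<eta> x y) * E y d) = (\<Sum>x<r. \<Sum>y<r. E x b * (q y * \<eta> x y) * E y d)"
    by (intro sum.cong refl) (simp only: lessThan_iff pq)
  also have "\<dots> = (\<Sum>y<r. \<Sum>x<r. E x b * (q y * \<eta> x y) * E y d)"
    by (rule sum.swap)
  also have "\<dots> = (\<Sum>y<r. q y * E y d * (\<Sum>x<r. E x b * \<eta> x y))"
    by (simp add: sum_distrib_left mult_ac)
  also have "\<dots> = (\<Sum>y<r. if y = b then q b * E b d else 0)"
    by (rule sum.cong) (use assms(2) in \<open>auto simp: sum_E_eta\<close>)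
  also have "\<dots> = q b * E b d" using assms(2) by simp
  finally show ?thesis using 1 by simp
qed

lemma E_sym: "b < r \<Longrightarrow> d < r \<Longrightarrow> E b d = parity_sign d * E d b"
  using E_grading[of "\<lambda>_. 1" "\<lambda>_. 1" b d] by simp

lemma E_mu:
  assumes "b < r" "d < r" "E b d \<noteq> 0"
  shows "mu b + mu d = 0"
proof -
  \<comment> \<open>The grading \<open>mu\<close> on the left index and its negative on the right
    one agree wherever the pairing is nonzero.\<close>
  have "of_real (mu x) * \<eta> x y = of_real (- mu y) * \<eta> x y" if "x < r" "y < r" for x y
    using eta_mu[OF that] by (cases "\<eta> x y = 0") (auto simp: add_eq_0_iff)
  from E_grading[of "\<lambda>x. of_real (mu x)" "\<lambda>x. of_real (- mu x)", OF this assms(1,2)]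
  have "of_real (mu d) * (parity_sign d * E d b) = - of_real (mu b) * E b d"
    by (simp add: mult.assoc)
  then have "complex_of_real (mu b + mu d) * E b d = 0"
    unfolding E_sym[OF assms(1,2), symmetric] by (simp add: distrib_right)
  with assms(3) show ?thesis by (simp flip: of_real_add)
qed

lemma E_parity:
  assumes "b < r" "d < r" "E b d \<noteq> 0"
  shows "od b = od d"
proof -
  have "parity_sign x * \<eta> x y = parity_sign y * \<eta> x y" if "x < r" "y < r" for x y
    using eta_parity[OF that] by (cases "\<eta> x y = 0") (auto simp: parity_sign_def)
  from E_grading[of parity_sign parity_sign, OF this assms(1,2)]
  have "parity_sign d * (parity_sign d * E d b) = parity_sign b * E b d"
    by (simp add: mult.assoc)
  then have "parity_sign d * E b d = parity_sign b * E b d"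
    unfolding E_sym[OF assms(1,2), symmetric] .
  with assms(3) show ?thesis by (auto simp: parity_sign_def split: if_splits)
qed

definition H :: "nat \<Rightarrow> nat \<Rightarrow> complex fls" where "H a b = fls_const (\<eta> a b)"
definition K :: "nat \<Rightarrow> nat \<Rightarrow> complex fls" where "K a b = fls_const (E a b)"

lemma fls_const_parity_sign: "fls_const (parity_sign a) = super_sign od a a"
  by (simp add: parity_sign_def super_sign_def)

lemma fls_const_sum: "fls_const (sum g I) = (\<Sum>i\<in>I. fls_const (g i))"
  by (induction I rule: infinite_finite_induct) (simp_all flip: fls_plus_const)

lemma H_sym: "a < r \<Longrightarrow> b < r \<Longrightarrow> H b a = super_sign od a b * H a b"
  using eta_sym[of a b] eta_parity[of a b]
  by (cases "\<eta> a b = 0") (auto simp: H_def super_sign_def)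

lemma K_sym: "a < r \<Longrightarrow> b < r \<Longrightarrow> K b a = super_sign od a b * K a b"
  using E_sym[of b a] E_parity[of a b]
  by (cases "E a b = 0") (auto simp: K_def super_sign_def parity_sign_def)

lemma H_parity: "a < r \<Longrightarrow> b < r \<Longrightarrow> H a b \<noteq> 0 \<Longrightarrow> od a = od b"
  using eta_parity by (auto simp: H_def)

lemma K_parity: "a < r \<Longrightarrow> b < r \<Longrightarrow> K a b \<noteq> 0 \<Longrightarrow> od a = od b"
  using E_parity by (auto simp: K_def)

lemma K_mu: "a < r \<Longrightarrow> b < r \<Longrightarrow> K a b \<noteq> 0 \<Longrightarrow> mu b = - mu a"
  using E_mu[of a b] by (auto simp: K_def)

lemma sum_K_H: "b < r \<Longrightarrow> c < r \<Longrightarrow> (\<Sum>a<r. K a b * H a c) = (if b = c then 1 else 0)"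
  using sum_E_eta[of b c, THEN arg_cong[of _ _ fls_const]]
  by (simp add: fls_const_sum K_def H_def)

text \<open>These diagonal signs turn the double contraction of the vacuum computation into a
  supertrace.\<close>

lemma sum_K_H': "b < r \<Longrightarrow> (\<Sum>a<r. K a b * H b a) = super_sign od b b"
  using sum_eta_E[of b b, THEN arg_cong[of _ _ fls_const]]
  by (simp add: fls_const_sum K_def H_def fls_const_parity_sign mult.commute)

text \<open>The contraction over both second indices; it recovers the derivatives from the
  \<open>J\<close> of negative index.\<close>

lemma sum_H_K:
  assumes "b < r" "c < r"
  shows "(\<Sum>a<r. H b a * K c a) = (if b = c then 1 else 0)"
proof -
  have "(\<Sum>a<r. \<eta> b a * E c a) = (\<Sum>a<r. parity_sign c * (\<eta> b a * E a c))"
  proof (rule sum.cong[OF refl])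
    fix a assume "a \<in> {..<r}"
    then have "E a c = parity_sign c * E c a" using E_sym[of a c] assms by simp
    then show "\<eta> b a * E c a = parity_sign c * (\<eta> b a * E a c)" by (auto simp: parity_sign_def)
  qed
  also have "\<dots> = (if b = c then 1 else 0)"
    using sum_eta_E[OF assms] by (auto simp: parity_sign_def simp flip: sum_distrib_left)
  finally show ?thesis
    by (auto dest: arg_cong[of _ _ fls_const] simp: fls_const_sum K_def H_def)
qed

text \<open>The coefficient of t^a_j d/dt^a_(j+k), kept also for negative j, where it enters the
  second-order terms.\<close>

definition vc :: "int \<Rightarrow> nat \<Rightarrow> int \<Rightarrow> complex fls" where
  "vc k a j = fls_const (of_real (pochhammer (mu a + of_int j + 1 / 2) (nat (k + 1))))"

lemma vc_cocycle:
  assumes "- 1 \<le> m" "- 1 \<le> n" "- 1 \<le> m + n"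
  shows "vc n a (j - n) * vc m a (j - n - m) - vc m a (j - m) * vc n a (j - m - n) =
    of_int (m - n) * vc (m + n) a (j - m - n)"
proof -
  define x where "x = mu a + of_int (j - m - n) + 1 / 2"
  have "mu a + of_int (j - n) + 1 / 2 = x + of_int m" "mu a + of_int (j - m) + 1 / 2 = x + of_int n"
    "mu a + of_int (j - n - m) + 1 / 2 = x" "mu a + of_int (j - m - n) + 1 / 2 = x"
    by (simp_all add: x_def)
  note args = this
  have "vc n a (j - n) * vc m a (j - n - m) - vc m a (j - m) * vc n a (j - m - n) =
    fls_const (of_real (pochhammer (x + of_int m) (nat (n + 1)) * pochhammer x (nat (m + 1))
    - pochhammer (x + of_int n) (nat (m + 1)) * pochhammer x (nat (n + 1))))"
    unfolding vc_def args by (simp add: fls_minus_const)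
  also have "\<dots> = of_int (m - n) * vc (m + n) a (j - m - n)"
    unfolding pochhammer_cocycle[OF assms] vc_def x_def[symmetric] by (simp add: fls_of_int)
  finally show ?thesis .
qed

text \<open>The summand 1/2 makes the arguments at j and -1 - j opposite once \<open>mu\<close>
  changes sign, so this is (-y)_N = (-1)^N (y - N + 1)_N with N = k + 1. It relates the coefficients
  met when either derivative of a second-order term is contracted.\<close>

lemma vc_reflect:
  assumes "- 1 \<le> k" "mu c = - mu a"
  shows "vc k c (- 1 - j) = (- 1) powi (k + 1) * vc k a (j - k)"
proof -
  have neg: "mu c + of_int (- 1 - j) + 1 / 2 = - (mu a + of_int j + 1 / 2)"
    using assms by simp
  have shift: "mu a + of_int j + 1 / 2 - of_nat (nat (k + 1)) + 1 = mu a + of_int (j - k) + 1 / 2"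
    using assms by simp
  have "pochhammer (mu c + of_int (- 1 - j) + 1 / 2) (nat (k + 1)) =
      (- 1) ^ nat (k + 1) * pochhammer (mu a + of_int (j - k) + 1 / 2) (nat (k + 1))"
    unfolding neg pochhammer_minus shift ..
  then show ?thesis using assms(1)
    by (simp add: vc_def power_int_def fls_const_power flip: fls_const_mult_const)
qed

end


section \<open>Commutators of the Virasoro operators with the generators\<close>

context virasoro_data
begin

section \<open>The mixed, second-order and pairing parts of the operators\<close>

definition \<epsilon> :: "complex fls" where "\<epsilon> = hbar ^ 2"

lemma \<epsilon>_nonzero: "\<epsilon> \<noteq> 0"
  by (simp add: \<epsilon>_def)

definition Lb :: "int \<Rightarrow> tseries \<Rightarrow> tseries" where
  "Lb k S e = Sum_any (\<lambda>m. if 0 \<le> int m + k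
     then \<Sum>a<r. vc k a (int m) * gen True (a, m) (gen False (a, nat (int m + k)) S) e else 0)"

definition Lc :: "int \<Rightarrow> tseries \<Rightarrow> tseries" where
  "Lc k S e = \<epsilon> / 2 * (\<Sum>m\<in>{- k..- 1}. \<Sum>a<r. \<Sum>b<r.
     (- 1) powi m * vc k b m * K a b * gen False (a, nat (- m - 1)) (gen False (b, nat (m + k)) S) e)"

definition Lq :: "int \<Rightarrow> tseries \<Rightarrow> tseries" where
  "Lq k S e = (if k = - 1 then 1 / (2 * \<epsilon>) *
     (\<Sum>a<r. \<Sum>b<r. H a b * gen True (a, 0) (gen True (b, 0) S) e) else 0)"

text \<open>Asking for N at least 1 keeps the shifted variable inside the cutoff:
  \<open>gen True (0, 1)\<close> does not vanish on monomials free of t^0_1.\<close>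

definition bound :: "(tvar \<Rightarrow>\<^sub>0 nat) \<Rightarrow> nat \<Rightarrow> bool" where
  "bound e N \<longleftrightarrow> 1 \<le> N \<and> (\<forall>v\<in>Poly_Mapping.keys e. snd v \<le> N)"

lemma bound_exists: "\<exists>N\<ge>n. bound e N"
proof -
  have "\<forall>v\<in>Poly_Mapping.keys e. snd v \<le> Max (insert 0 (snd ` Poly_Mapping.keys e))"
    by (intro ballI Max_ge) auto
  then show ?thesis
    by (intro exI[of _ "max n (max 1 (Max (insert 0 (snd ` Poly_Mapping.keys e))))"])
      (auto simp: bound_def le_max_iff_disj)
qed

lemma gen_True_beyond_bound: "bound e N \<Longrightarrow> N < m \<Longrightarrow> gen True (a, m) S e = 0"
  by (auto simp: bound_def gen_def t_mult_def)

definition Lb_trunc :: "nat \<Rightarrow> int \<Rightarrow> tseries \<Rightarrow> tseries" where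
  "Lb_trunc N k S e = (\<Sum>i\<in>{..N} \<times> {..<r}.
     (if 0 \<le> int (fst i) + k then vc k (snd i) (int (fst i)) else 0)
     * gen True (snd i, fst i) (gen False (snd i, nat (int (fst i) + k)) S) e)"

lemma Lb_eq_trunc:
  assumes "bound e N"
  shows "Lb k S e = Lb_trunc N k S e"
proof -
  have "Lb k S e = (\<Sum>m\<le>N. if 0 \<le> int m + k
     then \<Sum>a<r. vc k a (int m) * gen True (a, m) (gen False (a, nat (int m + k)) S) e else 0)"
    unfolding Lb_def
  proof (rule Sum_any.expand_superset)
    show "{m. (if 0 \<le> int m + k then \<Sum>a<r. vc k a (int m) * gen True (a, m)
      (gen False (a, nat (int m + k)) S) e else 0) \<noteq> 0} \<subseteq> {..N}"
    proof
      fix m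
      assume "m \<in> {m. (if 0 \<le> int m + k then \<Sum>a<r. vc k a (int m) * gen True (a, m)
        (gen False (a, nat (int m + k)) S) e else 0) \<noteq> 0}"
      then show "m \<in> {..N}"
        by (cases "N < m") (auto simp: gen_True_beyond_bound[OF assms] split: if_splits)
    qed
  qed simp
  also have "\<dots> = Lb_trunc N k S e"
    unfolding Lb_trunc_def sum.cartesian_product' by (intro sum.cong refl) auto
  finally show ?thesis .
qed

lemma local_gen_gen: "local_functional (\<lambda>S. c * gen x u (gen y v S) e)"
  using local_functional_scale[OF local_functional_compose[OF local_gen[rule_format, of x u e] local_gen]] .

lemma local_Lb_trunc: "local_functional (\<lambda>S. Lb_trunc N k S e)"
  unfolding Lb_trunc_def
  by (intro local_functional_sum local_gen_gen)

lemma local_Lb: "local_operator (Lb k)"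
proof
  fix e
  obtain N where "bound e N" using bound_exists by blast
  then show "local_functional (\<lambda>S. Lb k S e)"
    by (simp add: Lb_eq_trunc local_Lb_trunc)
qed

lemma local_Lc: "local_operator (Lc k)"
  unfolding Lc_def
  by (intro allI local_functional_scale[OF local_functional_sum] local_functional_sum local_gen_gen)

lemma local_Lq: "local_operator (Lq k)"
proof
  fix e
  have "local_functional (\<lambda>S. 1 / (2 * \<epsilon>) *
     (\<Sum>a<r. \<Sum>b<r. H a b * gen True (a, 0) (gen True (b, 0) S) e))"
    by (intro local_functional_scale[OF local_functional_sum] local_functional_sum local_gen_gen)
  then show "local_functional (\<lambda>S. Lq k S e)"
    by (cases "k = - 1") (simp_all add: Lq_def local_functional_zero)
qed

lemma gen_cong:
  assumes "A e = B e" "A (e + Poly_Mapping.single v 1) = B (e + Poly_Mapping.single v 1)"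
    "A (e - Poly_Mapping.single v 1) = B (e - Poly_Mapping.single v 1)"
  shows "gen x v A e = gen x v B e"
  using assms by (auto simp: gen_def t_mult_def t_deriv_def)

lemma bound_shift:
  assumes "bound e N" "snd v \<le> N"
  shows "bound (e + Poly_Mapping.single v 1) N" "bound (e - Poly_Mapping.single v 1) N"
  using assms by (auto simp: bound_def keys_plus_single keys_minus_single)

text \<open>A generator at e reads only e and its two neighbours in direction w, and these obey the
  same bound, so one truncation serves inside and outside the commutator.\<close>

lemma Lb_commutator_eq_trunc:
  assumes "bound e N" "snd w \<le> N"
  shows "Lb k (gen z w S) e - gen z w (Lb k S) e =
    Lb_trunc N k (gen z w S) e - gen z w (Lb_trunc N k S) e"
proof -
  have "gen z w (Lb k S) e = gen z w (Lb_trunc N k S) e"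
    by (intro gen_cong Lb_eq_trunc bound_shift assms)
  then show ?thesis by (simp add: Lb_eq_trunc[OF assms(1)])
qed

section \<open>Commutators with the mixed part\<close>

lemma Lb_trunc_commutator:
  assumes "S \<in> super_series r od" "fst w < r"
  shows "Lb_trunc N k (gen z w S) e - gen z w (Lb_trunc N k S) e =
    (\<Sum>i\<in>{..N} \<times> {..<r}. (if 0 \<le> int (fst i) + k then vc k (snd i) (int (fst i)) else 0)
      * contraction False (snd i, nat (int (fst i) + k)) z w * gen True (snd i, fst i) S e)
    + (\<Sum>i\<in>{..N} \<times> {..<r}. (if 0 \<le> int (fst i) + k then vc k (snd i) (int (fst i)) else 0)
      * super_sign od (fst (snd i, nat (int (fst i) + k))) (fst w)
      * contraction True (snd i, fst i) z w * gen False (snd i, nat (int (fst i) + k)) S e)"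
  by (rule sum_quadratic_commutator[OF assms]) (auto simp: Lb_trunc_def)

lemma Lb_gen_True:
  assumes S: "S \<in> super_series r od" and "a < r" "- 1 \<le> k"
  shows "Lb k (gen True (a, j) S) e - gen True (a, j) (Lb k S) e =
    (if k \<le> int j then vc k a (int j - k) * gen True (a, nat (int j - k)) S e else 0)"
proof -
  \<comment> \<open>The surviving term has level j - k, which reaches j + 1 for k = -1.\<close>
  obtain N where N: "Suc j \<le> N" "bound e N" using bound_exists by blast
  have "Lb k (gen True (a, j) S) e - gen True (a, j) (Lb k S) e =
    (\<Sum>i\<in>{..N} \<times> {..<r}. (if 0 \<le> int (fst i) + k then vc k (snd i) (int (fst i)) else 0)
      * contraction False (snd i, nat (int (fst i) + k)) True (a, j) * gen True (snd i, fst i) S e)"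
    using N Lb_trunc_commutator[OF S, of "(a, j)" N k True e] \<open>a < r\<close>
    by (simp add: Lb_commutator_eq_trunc[OF N(2)] contraction_def)
  also have "\<dots> = (\<Sum>i\<in>{..N} \<times> {..<r}. if i = (nat (int j - k), a) then
      (if k \<le> int j then vc k a (int j - k) * gen True (a, nat (int j - k)) S e else 0) else 0)"
    by (rule sum.cong) (use \<open>- 1 \<le> k\<close> in \<open>auto simp: contraction_def split: if_splits\<close>)
  also have "\<dots> = (if k \<le> int j then vc k a (int j - k) * gen True (a, nat (int j - k)) S e else 0)"
    using \<open>a < r\<close> \<open>- 1 \<le> k\<close> N(1) by auto
  finally show ?thesis .
qed

lemma Lb_gen_False:
  assumes S: "S \<in> super_series r od" and "a < r"
  shows "Lb k (gen False (a, j) S) e - gen False (a, j) (Lb k S) e =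
    - (if 0 \<le> int j + k then vc k a (int j) * gen False (a, nat (int j + k)) S e else 0)"
proof -
  obtain N where N: "j \<le> N" "bound e N" using bound_exists by blast
  have "Lb k (gen False (a, j) S) e - gen False (a, j) (Lb k S) e =
    (\<Sum>i\<in>{..N} \<times> {..<r}. (if 0 \<le> int (fst i) + k then vc k (snd i) (int (fst i)) else 0)
      * super_sign od (snd i) a * contraction True (snd i, fst i) False (a, j)
      * gen False (snd i, nat (int (fst i) + k)) S e)"
    using N Lb_trunc_commutator[OF S, of "(a, j)" N k False e] \<open>a < r\<close>
    by (simp add: Lb_commutator_eq_trunc[OF N(2)] contraction_def)
  \<comment> \<open>The contraction contains the sign of a against itself, which the exchange sign
    cancels; only -1 is left.\<close>
  also have "\<dots> = (\<Sum>i\<in>{..N} \<times> {..<r}. if i = (j, a) then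
      - (if 0 \<le> int j + k then vc k a (int j) * gen False (a, nat (int j + k)) S e else 0) else 0)"
    by (rule sum.cong)
      (use super_sign_sqr[of a a] in \<open>auto simp: contraction_def mult.assoc split: if_splits\<close>)
  also have "\<dots> = - (if 0 \<le> int j + k then vc k a (int j) * gen False (a, nat (int j + k)) S e else 0)"
    using \<open>a < r\<close> N(1) by auto
  finally show ?thesis .
qed

section \<open>Commutators with the second-order part\<close>

lemma Lc_commutator:
  assumes "S \<in> super_series r od" "fst w < r"
  shows "Lc k (gen z w S) e - gen z w (Lc k S) e =
    \<epsilon> / 2 * ((\<Sum>m\<in>{- k..- 1}. \<Sum>a<r. \<Sum>b<r. (- 1) powi m * vc k b m * K a b
      * contraction False (b, nat (m + k)) z w * gen False (a, nat (- m - 1)) S e)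
    + (\<Sum>m\<in>{- k..- 1}. \<Sum>a<r. \<Sum>b<r. (- 1) powi m * vc k b m * K a b
      * super_sign od b (fst w) * contraction False (a, nat (- m - 1)) z w * gen False (b, nat (m + k)) S e))"
proof -
  define c where "c i = (- 1) powi (fst i) * vc k (snd (snd i)) (fst i) * K (fst (snd i)) (snd (snd i))"
    for i :: "int \<times> nat \<times> nat"
  define Q where "Q S e = (\<Sum>i\<in>{- k..- 1} \<times> {..<r} \<times> {..<r}. c i *
    gen False (fst (snd i), nat (- fst i - 1)) (gen False (snd (snd i), nat (fst i + k)) S) e)" for S e
  have L: "Lc k S = (\<lambda>e. \<epsilon> / 2 * Q S e)" for S
    unfolding Q_def sum_triple_product c_def by (auto simp: Lc_def)
  have "Q (gen z w S) e - gen z w (Q S) e =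
    (\<Sum>i\<in>{- k..- 1} \<times> {..<r} \<times> {..<r}. c i * contraction False (snd (snd i), nat (fst i + k)) z w
      * gen False (fst (snd i), nat (- fst i - 1)) S e)
    + (\<Sum>i\<in>{- k..- 1} \<times> {..<r} \<times> {..<r}. c i * super_sign od (fst (snd (snd i), nat (fst i + k))) (fst w)
      * contraction False (fst (snd i), nat (- fst i - 1)) z w * gen False (snd (snd i), nat (fst i + k)) S e)"
    by (rule sum_quadratic_commutator[OF assms]) (auto simp: Q_def c_def dest: K_parity)
  then show ?thesis
    unfolding sum_triple_product c_def
    by (simp only: L gen_linear flip: right_diff_distrib) simp
qed

lemma Lc_gen_False:
  "S \<in> super_series r od \<Longrightarrow> a < r \<Longrightarrow> Lc k (gen False (a, j) S) e - gen False (a, j) (Lc k S) e = 0"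
  by (simp add: Lc_commutator contraction_def)

text \<open>Either derivative can be contracted, at m = j - k or at m = -1 - j, and both leave a
  derivative of level k - 1 - j. Reflection of the coefficient and graded symmetry of the inverse
  pairing make the two results equal, which removes the factor 1/2.\<close>

lemma Lc_gen_True:
  assumes S: "S \<in> super_series r od" and "a < r" "- 1 \<le> k"
  shows "Lc k (gen True (a, j) S) e - gen True (a, j) (Lc k S) e =
    (if int j < k then \<epsilon> * (- 1) powi (int j - k) * vc k a (int j - k)
      * (\<Sum>b<r. K b a * gen False (b, nat (k - 1 - int j)) S e) else 0)"
proof (cases "int j < k")
  case True
  define X where "X = (- 1) powi (int j - k) * vc k a (int j - k)
      * (\<Sum>b<r. K b a * gen False (b, nat (k - 1 - int j)) S e)"
  have "(\<Sum>m\<in>{- k..- 1}. \<Sum>b<r. \<Sum>c<r. (- 1) powi m * vc k c m * K b c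
      * contraction False (c, nat (m + k)) True (a, j) * gen False (b, nat (- m - 1)) S e) =
    (\<Sum>m\<in>{- k..- 1}. \<Sum>b<r. \<Sum>c<r. if c = a then if m = int j - k then
      (- 1) powi (int j - k) * vc k a (int j - k) * (K b a * gen False (b, nat (k - 1 - int j)) S e) else 0 else 0)"
    by (intro sum.cong refl) (auto simp: contraction_def algebra_simps)
  also have "\<dots> = (\<Sum>m\<in>{- k..- 1}. if m = int j - k then X else 0)"
    using \<open>a < r\<close> by (intro sum.cong refl) (auto simp: X_def sum_distrib_left)
  also have "\<dots> = X" using True by simp
  finally have 1: "(\<Sum>m\<in>{- k..- 1}. \<Sum>b<r. \<Sum>c<r. (- 1) powi m * vc k c m * K b c
      * contraction False (c, nat (m + k)) True (a, j) * gen False (b, nat (- m - 1)) S e) = X" .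
  have coeff: "(- 1) powi (- 1 - int j) * vc k c (- 1 - int j) * K a c * super_sign od c a =
    (- 1) powi (int j - k) * vc k a (int j - k) * K c a" if "c < r" for c
  proof (cases "K a c = 0")
    case True
    then show ?thesis using K_sym[of a c] \<open>a < r\<close> that by simp
  next
    case False
    have "vc k c (- 1 - int j) = (- 1) powi (k + 1) * vc k a (int j - k)"
      by (rule vc_reflect[OF \<open>- 1 \<le> k\<close> K_mu]) (use False \<open>a < r\<close> that in auto)
    then show ?thesis using K_sym[of a c] \<open>a < r\<close> that
      by (auto simp: minus_one_powi super_sign_sym[of c])
  qed
  have "(\<Sum>m\<in>{- k..- 1}. \<Sum>b<r. \<Sum>c<r. (- 1) powi m * vc k c m * K b c
      * super_sign od c a * contraction False (b, nat (- m - 1)) True (a, j) * gen False (c, nat (m + k)) S e) =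
    (\<Sum>m\<in>{- k..- 1}. \<Sum>b<r. if b = a then if m = - 1 - int j then X else 0 else 0)"
  proof (intro sum.cong refl)
    fix m b assume m: "m \<in> {- k..- 1}"
    have "(\<Sum>c<r. (- 1) powi (- 1 - int j) * vc k c (- 1 - int j) * K a c * super_sign od c a
      * gen False (c, nat (k - 1 - int j)) S e) = X"
      unfolding X_def sum_distrib_left
      by (intro sum.cong refl) (simp only: coeff lessThan_iff, simp only: mult.assoc)
    then show "(\<Sum>c<r. (- 1) powi m * vc k c m * K b c
      * super_sign od c a * contraction False (b, nat (- m - 1)) True (a, j) * gen False (c, nat (m + k)) S e) =
      (if b = a then if m = - 1 - int j then X else 0 else 0)"
      using m by (auto simp: contraction_def algebra_simps)
  qed
  also have "\<dots> = (\<Sum>m\<in>{- k..- 1}. if m = - 1 - int j then X else 0)"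
    using \<open>a < r\<close> by (intro sum.cong refl) simp
  also have "\<dots> = X" using True by simp
  finally have 2: "(\<Sum>m\<in>{- k..- 1}. \<Sum>b<r. \<Sum>c<r. (- 1) powi m * vc k c m * K b c
      * super_sign od c a * contraction False (b, nat (- m - 1)) True (a, j) * gen False (c, nat (m + k)) S e) = X" .
  have "Lc k (gen True (a, j) S) e - gen True (a, j) (Lc k S) e = \<epsilon> / 2 * (X + X)"
    using Lc_commutator[OF S, of "(a, j)" k True e] \<open>a < r\<close> by (simp only: 1 2 fst_conv)
  also have "\<dots> = \<epsilon> * X" by simp
  finally show ?thesis using True by (simp add: X_def mult.assoc)
next
  case False
  \<comment> \<open>Both derivatives have levels between 0 and k - 1, so neither meets j.\<close>
  have "contraction False (b, nat (m + k)) True (a, j) = 0"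
    "contraction False (b, nat (- m - 1)) True (a, j) = 0" if "m \<in> {- k..- 1}" for m b
    using that False by (auto simp: contraction_def)
  then show ?thesis using False Lc_commutator[OF S, of "(a, j)" k True e] \<open>a < r\<close> by simp
qed

section \<open>Commutators with the pairing term\<close>

lemma Lq_commutator:
  assumes "S \<in> super_series r od" "fst w < r"
  shows "Lq (- 1) (gen z w S) e - gen z w (Lq (- 1) S) e =
    1 / (2 * \<epsilon>) * ((\<Sum>a<r. \<Sum>b<r. H a b * contraction True (b, 0) z w * gen True (a, 0) S e)
    + (\<Sum>a<r. \<Sum>b<r. H a b * super_sign od b (fst w) * contraction True (a, 0) z w * gen True (b, 0) S e))"
proof -
  define Q where "Q S e = (\<Sum>i\<in>{..<r} \<times> {..<r}. H (fst i) (snd i) *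
    gen True (fst i, 0) (gen True (snd i, 0) S) e)" for S e
  have L: "Lq (- 1) S = (\<lambda>e. 1 / (2 * \<epsilon>) * Q S e)" for S
    unfolding Q_def sum.cartesian_product' by (auto simp: Lq_def)
  have "Q (gen z w S) e - gen z w (Q S) e =
    (\<Sum>i\<in>{..<r} \<times> {..<r}. H (fst i) (snd i) * contraction True (snd i, 0) z w * gen True (fst i, 0) S e)
    + (\<Sum>i\<in>{..<r} \<times> {..<r}. H (fst i) (snd i) * super_sign od (fst (snd i, 0 :: nat)) (fst w)
      * contraction True (fst i, 0) z w * gen True (snd i, 0) S e)"
    by (rule sum_quadratic_commutator[OF assms, where u = "\<lambda>i. (fst i, 0)" and v = "\<lambda>i. (snd i, 0)"])
      (auto simp: Q_def dest: H_parity)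
  then show ?thesis
    unfolding sum.cartesian_product'
    by (simp only: L gen_linear flip: right_diff_distrib) simp
qed

lemma Lq_gen_True:
  "S \<in> super_series r od \<Longrightarrow> a < r \<Longrightarrow> Lq k (gen True (a, j) S) e - gen True (a, j) (Lq k S) e = 0"
proof (cases "k = - 1")
  case False
  then have "Lq k S = (\<lambda>e. 0)" for S by (auto simp: Lq_def)
  then show ?thesis by (simp add: gen_def t_mult_def)
qed (simp add: Lq_commutator contraction_def)

text \<open>The two contractions agree by graded symmetry of the pairing, which doubles 1 / (2
  \<epsilon>) to 1 / \<epsilon>; in each the odd signs cancel in pairs and a single minus
  remains.\<close>

lemma Lq_gen_False:
  assumes S: "S \<in> super_series r od" and a: "a < r"
  shows "Lq k (gen False (a, j) S) e - gen False (a, j) (Lq k S) e =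
    - (if k = - 1 \<and> j = 0 then 1 / \<epsilon> * (\<Sum>b<r. H a b * gen True (b, 0) S e) else 0)"
proof (cases "k = - 1")
  case False
  then have "Lq k S = (\<lambda>e. 0)" for S by (auto simp: Lq_def)
  then show ?thesis using False by (simp add: gen_def t_deriv_def)
next
  case True
  define X where "X = - (\<Sum>b<r. H a b * gen True (b, 0) S e)"
  have "(\<Sum>b<r. \<Sum>c<r. H b c * contraction True (c, 0) False (a, j) * gen True (b, 0) S e) =
    (\<Sum>b<r. \<Sum>c<r. if c = a then if j = 0 then - (H a b * gen True (b, 0) S e) else 0 else 0)"
  proof (intro sum.cong refl)
    fix b c assume "b \<in> {..<r}" "c \<in> {..<r}"
    then show "H b c * contraction True (c, 0) False (a, j) * gen True (b, 0) S e =
      (if c = a then if j = 0 then - (H a b * gen True (b, 0) S e) else 0 else 0)"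
      using H_sym[of a b] H_parity[of a b] a
      by (cases "H a b = 0") (auto simp: contraction_def super_sign_def)
  qed
  also have "\<dots> = (if j = 0 then X else 0)"
    using a by (simp add: X_def sum_negf)
  finally have 1: "(\<Sum>b<r. \<Sum>c<r. H b c * contraction True (c, 0) False (a, j) * gen True (b, 0) S e) =
    (if j = 0 then X else 0)" .
  have "(\<Sum>b<r. \<Sum>c<r. H b c * super_sign od c a * contraction True (b, 0) False (a, j) * gen True (c, 0) S e) =
    (\<Sum>b<r. if b = a then if j = 0 then X else 0 else 0)"
  proof (intro sum.cong refl)
    fix b assume "b \<in> {..<r}"
    have "(\<Sum>c<r. H a c * super_sign od c a * - super_sign od a a * gen True (c, 0) S e) = X"
      unfolding X_def sum_negf[symmetric]
    proof (intro sum.cong refl)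
      fix c assume "c \<in> {..<r}"
      then show "H a c * super_sign od c a * - super_sign od a a * gen True (c, 0) S e =
        - (H a c * gen True (c, 0) S e)"
        using H_parity[of a c] a
        by (cases "H a c = 0") (auto simp: super_sign_def)
    qed
    then show "(\<Sum>c<r. H b c * super_sign od c a * contraction True (b, 0) False (a, j) * gen True (c, 0) S e) =
      (if b = a then if j = 0 then X else 0 else 0)"
      by (auto simp: contraction_def)
  qed
  also have "\<dots> = (if j = 0 then X else 0)" using a by simp
  finally have 2: "(\<Sum>b<r. \<Sum>c<r. H b c * super_sign od c a * contraction True (b, 0) False (a, j)
    * gen True (c, 0) S e) = (if j = 0 then X else 0)" .
  show ?thesis
    using Lq_commutator[OF S, of "(a, j)" False e] a True
    by (simp add: 1 2 X_def)
qed

end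


section \<open>The Virasoro relations for an abstract graded pairing\<close>

context virasoro_data
begin

text \<open>The constant of L_0, in the form in which the double contraction of L_1 with L_(-1)
  produces it: minus a quarter of a supertrace.\<close>

definition \<kappa> :: "complex fls" where
  "\<kappa> = - (\<Sum>b<r. super_sign od b b * vc 1 b (- 1)) / 4"

definition L :: "int \<Rightarrow> tseries \<Rightarrow> tseries" where
  "L k S e = Lb k S e + Lc k S e + Lq k S e + (if k = 0 then \<kappa> else 0) * S e"

definition J :: "nat \<Rightarrow> int \<Rightarrow> tseries \<Rightarrow> tseries" where
  "J a j S e = (if 0 \<le> j then gen True (a, nat j) S e
     else \<epsilon> * (- 1) powi j * (\<Sum>b<r. K b a * gen False (b, nat (- 1 - j)) S e))"

lemma local_L: "local_operator (L k)"
  unfolding L_def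
  by (intro allI local_functional_add local_functional_eval local_Lb[rule_format]
      local_Lc[rule_format] local_Lq[rule_format])

lemma local_J: "local_operator (J a j)"
proof
  fix e
  have "local_functional (\<lambda>S. \<epsilon> * (- 1) powi j * (\<Sum>b<r. K b a * gen False (b, nat (- 1 - j)) S e))"
    by (intro local_functional_scale[OF local_functional_sum] local_functional_scale[OF local_gen[rule_format]])
  then show "local_functional (\<lambda>S. J a j S e)"
    using local_gen by (cases "0 \<le> j") (simp_all add: J_def)
qed

lemmas L_linear = local_functional_linear[OF local_L[rule_format]]
lemmas J_linear = local_functional_linear[OF local_J[rule_format]]

lemma super_series_iff: "S \<in> super_series r od \<longleftrightarrow> (\<forall>e. \<not> super_monomial r od e \<longrightarrow> S e = 0)"
  by (auto simp: super_series_def)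

lemma L_super_series:
  assumes S: "S \<in> super_series r od" shows "L k S \<in> super_series r od"
proof -
  have "gen x v (gen y w S) e = 0" if "\<not> super_monomial r od e" for x v y w e
    using that gen_super_series[OF gen_super_series[OF S]] by (simp add: super_series_iff)
  then show ?thesis
    using S by (simp add: super_series_iff L_def Lb_def Lc_def Lq_def cong: if_cong)
qed

lemma L_gen_commutator:
  "L k (gen x v S) e - gen x v (L k S) e =
    (Lb k (gen x v S) e - gen x v (Lb k S) e) + (Lc k (gen x v S) e - gen x v (Lc k S) e)
    + (Lq k (gen x v S) e - gen x v (Lq k S) e)"
proof -
  have "L k S = (\<lambda>e. Lb k S e + Lc k S e + Lq k S e + (if k = 0 then \<kappa> else 0) * S e)"
    by (auto simp: L_def)
  then show ?thesis by (simp only: gen_linear L_def) (simp add: algebra_simps)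
qed

text \<open>The mixed part answers for j at least k and the second-order part for j below k;
  \<open>J\<close> is built so that both ranges obey one formula.\<close>

lemma L_gen_True:
  assumes "S \<in> super_series r od" "a < r" "- 1 \<le> k"
  shows "L k (gen True (a, j) S) e - gen True (a, j) (L k S) e =
    vc k a (int j - k) * J a (int j - k) S e"
  using Lb_gen_True[OF assms, of j e] Lc_gen_True[OF assms, of j e] Lq_gen_True[OF assms(1,2), of k j e]
  unfolding L_gen_commutator J_def by (simp add: mult_ac diff_diff_eq2)

lemma L_gen_False:
  assumes "S \<in> super_series r od" "a < r" "- 1 \<le> k"
  shows "L k (gen False (a, j) S) e - gen False (a, j) (L k S) e =
    - vc k a (int j) * (if 0 \<le> int j + k then gen False (a, nat (int j + k)) S e
      else 1 / \<epsilon> * (\<Sum>b<r. H a b * gen True (b, 0) S e))"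
proof -
  \<comment> \<open>Only one case falls below level 0; there the Pochhammer symbol is empty and the
    pairing term supplies the answer.\<close>
  have "int j + k < 0 \<longleftrightarrow> k = - 1 \<and> j = 0" using assms(3) by auto
  moreover have "vc (- 1) a i = 1" for i by (simp add: vc_def)
  ultimately show ?thesis
    using Lb_gen_False[OF assms(1,2), of k j e] Lc_gen_False[OF assms(1,2), of k j e]
      Lq_gen_False[OF assms(1,2), of k j e]
    unfolding L_gen_commutator by (auto simp: not_le)
qed

lemma L_J_commutator:
  assumes S: "S \<in> super_series r od" and a: "a < r" and k: "- 1 \<le> k"
  shows "L k (J a j S) e = J a j (L k S) e + vc k a (j - k) * J a (j - k) S e"
proof (cases "0 \<le> j")
  case True
  then have "J a j S = gen True (a, nat j) S" for S by (auto simp: J_def)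
  then show ?thesis using L_gen_True[OF S a k, of "nat j" e] True by (simp add: algebra_simps)
next
  case False
  define i where "i = nat (- 1 - j)"
  define c where "c = \<epsilon> * (- 1) powi j"
  have j: "j = - 1 - int i" using False by (simp add: i_def)
  have J: "J a j S = (\<lambda>e. c * (\<Sum>b<r. K b a * gen False (b, i) S e))" for S
    using False by (auto simp: J_def c_def i_def)
  have "L k (J a j S) e - J a j (L k S) e =
    c * (\<Sum>b<r. K b a * (L k (gen False (b, i) S) e - gen False (b, i) (L k S) e))"
    by (simp add: J L_linear right_diff_distrib sum_subtractf)
  also have "\<dots> = c * (\<Sum>b<r. K b a * (- vc k b (int i) * (if 0 \<le> int i + k
      then gen False (b, nat (int i + k)) S e else 1 / \<epsilon> * (\<Sum>d<r. H b d * gen True (d, 0) S e))))"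
    by (intro arg_cong[of _ _ "(*) c"] sum.cong refl) (simp only: L_gen_False[OF S _ k] lessThan_iff)
  also have "\<dots> = vc k a (j - k) * J a (j - k) S e"
  proof (cases "0 \<le> int i + k")
    case True
    have idx: "- 1 - (j - k) = int i + k" using j by simp
    have Jk: "J a (j - k) S e = \<epsilon> * (- 1) powi (j - k) * (\<Sum>b<r. K b a * gen False (b, nat (int i + k)) S e)"
      unfolding J_def idx using True j by simp
    \<comment> \<open>Reflection moves the coefficient from b to a, so that it leaves the sum over
      b. Its sign, together with the minus of \<open>L_gen_False\<close>, turns (-1)^j into
      (-1)^(j-k).\<close>
    have coeff: "K b a * vc k b (int i) = (- 1) powi (k + 1) * vc k a (j - k) * K b a" if "b < r" for b
    proof (cases "K b a = 0")
      case False
      then have "mu b = - mu a" using K_mu[of b a] that a by simp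
      then show ?thesis using vc_reflect[OF k, of b a j] j by simp
    qed simp
    have "c * (\<Sum>b<r. K b a * (- vc k b (int i) * gen False (b, nat (int i + k)) S e)) =
      c * (\<Sum>b<r. - ((K b a * vc k b (int i)) * gen False (b, nat (int i + k)) S e))"
      by (simp add: mult.assoc)
    also have "\<dots> = c * (\<Sum>b<r. - (((- 1) powi (k + 1) * vc k a (j - k) * K b a) * gen False (b, nat (int i + k)) S e))"
      by (intro arg_cong[of _ _ "(*) c"] sum.cong refl) (simp only: coeff lessThan_iff)
    also have "\<dots> = vc k a (j - k) * J a (j - k) S e"
      by (auto simp: Jk c_def sum_distrib_left sum_negf minus_one_powi mult_ac)
    finally show ?thesis using True by simp
  next
    case False
    then have ki: "k = - 1" "i = 0" using k by auto
    \<comment> \<open>Here L_(-1) takes derivatives back to variables, and contracting the inverse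
      pairing with the pairing isolates t^a_0.\<close>
    have "(\<Sum>b<r. K b a * (\<Sum>d<r. H b d * gen True (d, 0) S e)) =
      (\<Sum>b<r. \<Sum>d<r. K b a * H b d * gen True (d, 0) S e)"
      by (simp add: sum_distrib_left mult.assoc)
    also have "\<dots> = (\<Sum>d<r. \<Sum>b<r. K b a * H b d * gen True (d, 0) S e)" by (rule sum.swap)
    also have "\<dots> = (\<Sum>d<r. if d = a then gen True (d, 0) S e else 0)"
      by (intro sum.cong refl) (use a in \<open>auto simp: sum_K_H simp flip: sum_distrib_right\<close>)
    also have "\<dots> = gen True (a, 0) S e" using a by simp
    finally have *: "(\<Sum>b<r. K b a * (\<Sum>d<r. H b d * gen True (d, 0) S e)) = gen True (a, 0) S e" .
    \<comment> \<open>For j = -1 the factor c is -\<epsilon>, which cancels both the minus sign and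
      1 / \<epsilon>.\<close>
    have "c * (\<Sum>b<r. K b a * (- vc k b (int i) * (1 / \<epsilon> * (\<Sum>d<r. H b d * gen True (d, 0) S e)))) =
      (\<Sum>b<r. K b a * (\<Sum>d<r. H b d * gen True (d, 0) S e))"
      using \<epsilon>_nonzero ki j by (simp add: vc_def c_def minus_one_powi sum_distrib_left mult_ac)
    with * ki j show ?thesis by (simp add: J_def vc_def)
  qed
  finally show ?thesis by (simp add: algebra_simps)
qed

section \<open>The defect of the bracket and its centrality\<close>

definition defect :: "int \<Rightarrow> int \<Rightarrow> tseries \<Rightarrow> tseries" where
  "defect m n S e = L m (L n S) e - L n (L m S) e - of_int (m - n) * L (m + n) S e"

lemma local_defect: "local_operator (defect m n)"
  unfolding defect_def
  by (intro allI local_functional_diff local_functional_scale[OF local_L[rule_format]]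
      local_functional_compose[OF local_L[rule_format] local_L])

lemmas defect_linear = local_functional_linear[OF local_defect[rule_format]]

lemma defect_super_series: "S \<in> super_series r od \<Longrightarrow> defect m n S \<in> super_series r od"
  using L_super_series[OF L_super_series] L_super_series
  by (simp add: super_series_iff defect_def)

lemma L_L_J:
  assumes S: "S \<in> super_series r od" and a: "a < r" and m: "- 1 \<le> m" and n: "- 1 \<le> n"
  shows "L m (L n (J a j S)) e = J a j (L m (L n S)) e + vc m a (j - m) * J a (j - m) (L n S) e
    + vc n a (j - n) * J a (j - n) (L m S) e
    + vc n a (j - n) * vc m a (j - n - m) * J a (j - n - m) S e"
proof -
  have "L n (J a j S) = (\<lambda>e. J a j (L n S) e + vc n a (j - n) * J a (j - n) S e)"
    using L_J_commutator[OF S a n] by blast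
  then show ?thesis
    by (simp add: L_linear L_J_commutator[OF S a m] L_J_commutator[OF L_super_series[OF S] a m]
      distrib_left mult.assoc add.assoc)
qed

text \<open>The cross terms in \<open>L_L_J\<close> are symmetric in m and n and drop out. The rest
  is the cocycle identity times J_(j-m-n), which is just what L_(m+n) contributes.\<close>

lemma defect_J:
  assumes S: "S \<in> super_series r od" and a: "a < r" and m: "- 1 \<le> m" and n: "- 1 \<le> n"
    and mn: "- 1 \<le> m + n"
  shows "defect m n (J a j S) e = J a j (defect m n S) e"
proof -
  have "defect m n S = (\<lambda>e. L m (L n S) e - L n (L m S) e - of_int (m - n) * L (m + n) S e)"
    by (auto simp: defect_def)
  then have 1: "J a j (defect m n S) e =
    J a j (L m (L n S)) e - J a j (L n (L m S)) e - of_int (m - n) * J a j (L (m + n) S) e"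
    by (simp only: J_linear)
  have "vc n a (j - n) * vc m a (j - n - m) * J a (j - n - m) S e
    - vc m a (j - m) * vc n a (j - m - n) * J a (j - m - n) S e
    = (vc n a (j - n) * vc m a (j - n - m) - vc m a (j - m) * vc n a (j - m - n)) * J a (j - m - n) S e"
    by (simp add: left_diff_distrib diff_diff_eq add.commute)
  also have "\<dots> = of_int (m - n) * (vc (m + n) a (j - (m + n)) * J a (j - (m + n)) S e)"
    unfolding vc_cocycle[OF m n mn] by (simp add: diff_diff_eq mult.assoc)
  finally show ?thesis
    unfolding 1 defect_def L_L_J[OF S a m n] L_L_J[OF S a n m] L_J_commutator[OF S a mn]
    by (simp add: algebra_simps)
qed

lemma gen_False_eq_J:
  assumes "b < r"
  shows "gen False (b, i) S e = 1 / \<epsilon> * (- 1) powi (- 1 - int i) * (\<Sum>a<r. H b a * J a (- 1 - int i) S e)"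
proof -
  have "(\<Sum>a<r. H b a * (\<Sum>c<r. K c a * gen False (c, i) S e)) =
    (\<Sum>a<r. \<Sum>c<r. H b a * K c a * gen False (c, i) S e)"
    by (simp add: sum_distrib_left mult.assoc)
  also have "\<dots> = (\<Sum>c<r. \<Sum>a<r. H b a * K c a * gen False (c, i) S e)" by (rule sum.swap)
  also have "\<dots> = (\<Sum>c<r. if c = b then gen False (c, i) S e else 0)"
    by (intro sum.cong refl) (use assms in \<open>auto simp: sum_H_K simp flip: sum_distrib_right\<close>)
  also have "\<dots> = gen False (b, i) S e" using assms by simp
  finally have *: "(\<Sum>a<r. H b a * (\<Sum>c<r. K c a * gen False (c, i) S e)) = gen False (b, i) S e" .
  have "(\<Sum>a<r. H b a * J a (- 1 - int i) S e) =
    \<epsilon> * (- 1) powi (- 1 - int i) * (\<Sum>a<r. H b a * (\<Sum>c<r. K c a * gen False (c, i) S e))"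
    by (simp add: J_def sum_distrib_left mult_ac)
  then show ?thesis using * \<epsilon>_nonzero by (auto simp: minus_one_powi)
qed

lemma defect_gen:
  assumes S: "S \<in> super_series r od" and v: "fst v < r" and m: "- 1 \<le> m" and n: "- 1 \<le> n"
    and mn: "- 1 \<le> m + n"
  shows "defect m n (gen x v S) e = gen x v (defect m n S) e"
proof (cases x)
  case True
  then have "gen x v S = J (fst v) (int (snd v)) S" for S by (auto simp: J_def)
  then show ?thesis using defect_J[OF S v m n mn] by simp
next
  case False
  have *: "gen x v S = (\<lambda>e. 1 / \<epsilon> * (- 1) powi (- 1 - int (snd v)) *
    (\<Sum>a<r. H (fst v) a * J a (- 1 - int (snd v)) S e))" for S
    using gen_False_eq_J[OF v, of "snd v"] False by auto
  show ?thesis unfolding * defect_linear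
    by (intro arg_cong[of _ _ "(*) (1 / \<epsilon> * (- 1) powi (- 1 - int (snd v)))"] sum.cong refl)
      (simp only: defect_J[OF S _ m n mn] lessThan_iff)
qed

section \<open>Constant terms of iterated operators on 1\<close>

lemma gen_tmonom_0: "gen False v (tmonom 0) e = 0"
proof -
  have "e + Poly_Mapping.single v 1 \<noteq> 0"
    using keys_plus_single[of e v] by force
  then show ?thesis by (simp add: gen_def t_deriv_def)
qed

lemma gen_True_at_0: "gen True v S 0 = - (if v = (0, 1) then S 0 else 0)"
  by (simp add: gen_def t_mult_def)

lemma tmonom_super_series: "super_monomial r od e \<Longrightarrow> tmonom e \<in> super_series r od"
  by (auto simp: super_series_def)

lemma gen_zero: "gen x v (\<lambda>e. 0) e = 0"
  by (rule local_functional_zero_arg[OF local_gen[rule_format]])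

lemma gen_tmonom_0': "gen False v (tmonom 0) = (\<lambda>e. 0)"
  using gen_tmonom_0 by blast

text \<open>The mixed and second-order parts apply a derivative to 1 first.\<close>

lemma L_tmonom_0: "L n (tmonom 0) e = Lq n (tmonom 0) e + (if n = 0 then \<kappa> else 0) * tmonom 0 e"
  by (simp add: L_def Lb_def Lc_def gen_tmonom_0' gen_zero cong: if_cong)

text \<open>A product with a variable has no constant term, so only the shift is visible: level 1,
  class 0.\<close>

lemma Lb_at_0: "Lb k S 0 = - (if - 1 \<le> k then vc k 0 1 * gen False (0, nat (k + 1)) S 0 else 0)"
proof -
  have "bound 0 1" by (simp add: bound_def)
  then have "Lb k S 0 = Lb_trunc 1 k S 0" by (rule Lb_eq_trunc)
  also have "\<dots> = (\<Sum>i\<in>{..1::nat} \<times> {..<r}. if i = (1, 0) then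
      - (if - 1 \<le> k then vc k 0 1 * gen False (0, nat (k + 1)) S 0 else 0) else 0)"
    unfolding Lb_trunc_def
    by (rule sum.cong) (auto simp: gen_True_at_0 add.commute)
  also have "\<dots> = - (if - 1 \<le> k then vc k 0 1 * gen False (0, nat (k + 1)) S 0 else 0)"
    using r_pos by simp
  finally show ?thesis .
qed

lemma Lq_at_0: "Lq k S 0 = 0"
  by (simp add: Lq_def gen_True_at_0)

text \<open>This is L_(-1) applied to 1, the only nonconstant series among the L_n 1.\<close>

abbreviation "vac \<equiv> Lq (- 1) (tmonom 0)"

text \<open>The derivative kills 1, so its value on \<open>vac\<close> is minus its commutator with
  the pairing term.\<close>

lemma gen_vac:
  assumes "a < r"
  shows "gen False (a, j) vac e =
    (if j = 0 then 1 / \<epsilon> * (\<Sum>b<r. H a b * gen True (b, 0) (tmonom 0) e) else 0)"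
proof -
  have "tmonom 0 \<in> super_series r od"
    by (rule tmonom_super_series) (simp add: super_monomial_def)
  from Lq_gen_False[OF this assms, of "- 1" j e] show ?thesis
    using local_functional_zero_arg[OF local_Lq[rule_format, of "- 1" e]]
    by (auto simp: gen_tmonom_0')
qed

lemma gen_gen_True_tmonom_0:
  assumes "a < r" "b < r"
  shows "gen False (a, i) (gen True (b, 0) (tmonom 0)) 0 = (if a = b \<and> i = 0 then 1 else 0)"
proof -
  have "tmonom 0 \<in> super_series r od"
    by (rule tmonom_super_series) (simp add: super_monomial_def)
  from gen_swap[OF this, of "(a, i)" "(b, 0)" False True 0] show ?thesis
    using assms by (simp add: gen_tmonom_0' gen_zero contraction_def)
qed

lemma gen_gen_vac:
  assumes "a < r" "b < r"
  shows "gen False (a, i) (gen False (b, j) vac) 0 = (if i = 0 \<and> j = 0 then 1 / \<epsilon> * H b a else 0)"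
proof (cases "j = 0")
  case True
  have "gen False (b, j) vac = (\<lambda>e. 1 / \<epsilon> * (\<Sum>c<r. H b c * gen True (c, 0) (tmonom 0) e))"
    using gen_vac[OF assms(2), of j] True by auto
  then have "gen False (a, i) (gen False (b, j) vac) 0 =
    1 / \<epsilon> * (\<Sum>c<r. H b c * gen False (a, i) (gen True (c, 0) (tmonom 0)) 0)"
    by (simp only: gen_linear)
  also have "(\<Sum>c<r. H b c * gen False (a, i) (gen True (c, 0) (tmonom 0)) 0) =
    (\<Sum>c<r. if c = a then if i = 0 then H b a else 0 else 0)"
    by (rule sum.cong) (use assms in \<open>auto simp: gen_gen_True_tmonom_0\<close>)
  also have "\<dots> = (if i = 0 then H b a else 0)" using assms by simp
  finally show ?thesis using True by simp
next
  case False
  have "gen False (b, j) vac = (\<lambda>e. 0)"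
    using gen_vac[OF assms(2), of j] False by auto
  then show ?thesis using False by (simp add: gen_zero)
qed

text \<open>Both derivatives must have level 0, which forces i = -1 and m = 1. The matrices then
  contract to diagonal signs, \<epsilon> cancels, and minus half of the supertrace is 2
  \<kappa>.\<close>

lemma Lc_vac_at_0: "Lc m vac 0 = (if m = 1 then 2 * \<kappa> else 0)"
proof -
  have "Lc m vac 0 = \<epsilon> / 2 * (\<Sum>i\<in>{- m..- 1}. \<Sum>a<r. \<Sum>b<r. if i = - 1 then if m = 1 then
      - vc 1 b (- 1) * K a b * (1 / \<epsilon> * H b a) else 0 else 0)"
    unfolding Lc_def
  proof (intro arg_cong[of _ _ "(*) (\<epsilon> / 2)"] sum.cong refl)
    fix i a b assume "i \<in> {- m..- 1}" "a \<in> {..<r}" "b \<in> {..<r}"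
    then show "(- 1) powi i * vc m b i * K a b * gen False (a, nat (- i - 1)) (gen False (b, nat (i + m)) vac) 0 =
      (if i = - 1 then if m = 1 then - vc 1 b (- 1) * K a b * (1 / \<epsilon> * H b a) else 0 else 0)"
      by (auto simp: gen_gen_vac minus_one_powi)
  qed
  also have "\<dots> = (if m = 1 then \<epsilon> / 2 * (\<Sum>a<r. \<Sum>b<r. - vc 1 b (- 1) * K a b * (1 / \<epsilon> * H b a)) else 0)"
    by (cases "m = 1") (simp_all cong: if_cong)
  also have "(\<Sum>a<r. \<Sum>b<r. - vc 1 b (- 1) * K a b * (1 / \<epsilon> * H b a)) =
    - (1 / \<epsilon>) * (\<Sum>a<r. \<Sum>b<r. vc 1 b (- 1) * (K a b * H b a))"
    by (simp add: sum_distrib_left sum_negf mult_ac)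
  also have "(\<Sum>a<r. \<Sum>b<r. vc 1 b (- 1) * (K a b * H b a)) = (\<Sum>b<r. \<Sum>a<r. vc 1 b (- 1) * (K a b * H b a))"
    by (rule sum.swap)
  also have "\<dots> = (\<Sum>b<r. super_sign od b b * vc 1 b (- 1))"
    by (intro sum.cong refl) (simp add: sum_K_H' flip: sum_distrib_left)
  finally show ?thesis using \<epsilon>_nonzero by (simp add: \<kappa>_def)
qed

lemma L_vac_at_0: "L m vac 0 = (if m = 1 then 2 * \<kappa> else 0)"
  using r_pos by (simp add: L_def Lb_at_0 Lq_at_0 Lc_vac_at_0 gen_vac gen_True_at_0)

lemma defect_tmonom_0:
  assumes "m \<noteq> n" "- 1 \<le> m" "- 1 \<le> n"
  shows "defect m n (tmonom 0) 0 = 0"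
proof -
  have 0: "L k (tmonom 0) 0 = (if k = 0 then \<kappa> else 0)" for k
    by (simp add: L_tmonom_0 Lq_at_0)
  have 2: "L m (L n (tmonom 0)) 0 = (if n = - 1 \<and> m = 1 then 2 * \<kappa> else 0)
    + (if n = 0 \<and> m = 0 then \<kappa> * \<kappa> else 0)" for m n
  proof -
    have "L n (tmonom 0) = (\<lambda>e. (if n = - 1 then 1 else 0) * vac e + (if n = 0 then \<kappa> else 0) * tmonom 0 e)"
    proof
      fix e show "L n (tmonom 0) e = (if n = - 1 then 1 else 0) * vac e + (if n = 0 then \<kappa> else 0) * tmonom 0 e"
        unfolding L_tmonom_0 by (auto simp: Lq_def)
    qed
    then have "L m (L n (tmonom 0)) 0 =
      (if n = - 1 then 1 else 0) * L m vac 0 + (if n = 0 then \<kappa> else 0) * L m (tmonom 0) 0"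
      by (simp only: L_linear)
    then show ?thesis by (auto simp: 0 L_vac_at_0)
  qed
  show ?thesis using assms unfolding defect_def 0 2 by auto
qed

lemma defect_eq_0:
  assumes mn: "m \<noteq> n" "- 1 \<le> m" "- 1 \<le> n" "- 1 \<le> m + n" and S: "S \<in> super_series r od"
  shows "defect m n S e = 0"
proof -
  have monom: "defect m n (tmonom e) 0 = 0" if e: "super_monomial r od e" for e
  proof (cases "e = 0")
    case True
    then show ?thesis using defect_tmonom_0[OF mn(1-3)] by simp
  next
    case False
    then obtain v where v: "v \<in> Poly_Mapping.keys e" using keys_eq_empty by blast
    define e' where "e' = e - Poly_Mapping.single v 1"
    have e': "tmonom e' \<in> super_series r od"
      unfolding e'_def using super_monomial_minus[OF e] by (intro tmonom_super_series) simp
    have vr: "fst v < r" using e v by (simp add: super_monomial_def)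
    have eq: "e'' - Poly_Mapping.single v 1 = e' \<longleftrightarrow> e'' = e" if "v \<in> Poly_Mapping.keys e''" for e''
      unfolding e'_def using minus_single_plus_single[OF v] minus_single_plus_single[OF that] by auto
    \<comment> \<open>Adding back the shift turns \<open>gen True v\<close> into plain
      multiplication by t_v. The defect commutes with it, and a product with t_v has no constant
      term, so no induction on e is needed.\<close>
    have "tmonom e = (\<lambda>e''. koszul_sign od v e *
      (gen True v (tmonom e') e'' + (if v = (0, 1) then 1 else 0) * tmonom e' e''))"
    proof
      fix e'' show "tmonom e e'' = koszul_sign od v e *
        (gen True v (tmonom e') e'' + (if v = (0, 1) then 1 else 0) * tmonom e' e'')"
      proof (cases "v \<in> Poly_Mapping.keys e''")
        case True
        then show ?thesis using eq[OF True] e v koszul_sign_sqr[of od v e]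
          by (auto simp: gen_def t_mult_def)
      next
        case False
        then have "e'' \<noteq> e" using v by auto
        with False show ?thesis by (auto simp: gen_def t_mult_def)
      qed
    qed
    then have "defect m n (tmonom e) 0 = koszul_sign od v e *
      (defect m n (gen True v (tmonom e')) 0 + (if v = (0, 1) then 1 else 0) * defect m n (tmonom e') 0)"
      by (simp only: defect_linear)
    also have "\<dots> = 0"
      unfolding defect_gen[OF e' vr mn(2-4)] by (simp add: gen_True_at_0)
    finally show ?thesis .
  qed
  have at_0: "defect m n S 0 = 0" if "S \<in> super_series r od" for S
  proof (rule local_functional_eq_0[OF local_defect[rule_format]])
    fix e assume "S e \<noteq> 0"
    then show "defect m n (tmonom e) 0 = 0"
      using that by (intro monom) (auto simp: super_series_def)
  qed
  show ?thesis using S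
  \<comment> \<open>Up to a nonzero factor, the coefficient at e is the one at e' of a derivative.
    Moving this derivative through the defect changes S, so S has to vary in the induction.\<close>
  proof (induction "sum (expo e) (Poly_Mapping.keys e)" arbitrary: e S rule: less_induct)
    case less
    show ?case
    proof (cases "e = 0 \<or> \<not> super_monomial r od e")
      case True
      then show ?thesis
        using at_0[OF less.prems] defect_super_series[OF less.prems] by (auto simp: super_series_iff)
    next
      case False
      then have e: "super_monomial r od e" by simp
      from False obtain v where v: "v \<in> Poly_Mapping.keys e" using keys_eq_empty by blast
      have vr: "fst v < r" using e v by (simp add: super_monomial_def)
      define e' where "e' = e - Poly_Mapping.single v 1"
      have "e' + Poly_Mapping.single v 1 = e"
        unfolding e'_def using minus_single_plus_single[OF v] by simp
      note e' = this
      have "sum (expo e') (Poly_Mapping.keys e') \<le> sum (expo e') (Poly_Mapping.keys e)"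
        unfolding e'_def by (rule sum_mono2) (auto simp: keys_minus_single)
      also have "\<dots> < sum (expo e) (Poly_Mapping.keys e)"
        using v by (intro sum_strict_mono_ex1)
          (auto simp: e'_def lookup_minus lookup_single when_def in_keys_iff intro!: bexI[of _ v])
      finally have "defect m n (gen False v S) e' = 0"
        using gen_super_series[OF less.prems] by (rule less.hyps)
      then have "gen False v (defect m n S) e' = 0"
        using defect_gen[OF less.prems vr mn(2-4)] by simp
      then have "koszul_sign od v e' * of_nat (expo e' v + 1) * defect m n S e = 0"
        using e' by (simp add: gen_def t_deriv_def)
      moreover have "koszul_sign od v e' \<noteq> 0"
        using koszul_sign_sqr[of od v e'] by auto
      moreover have "(of_nat (expo e' v + 1) :: complex fls) \<noteq> 0"
        using of_nat_neq_0[of "expo e' v", where 'a = complex]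
        by (simp only: fls_of_nat fls_const_eq_0_iff Suc_eq_plus1 not_False_eq_True)
      ultimately show ?thesis by simp
    qed
  qed
qed

theorem L_commutator:
  assumes "- 1 \<le> m" "- 1 \<le> n" "S \<in> super_series r od"
  shows "L m (L n S) e - L n (L m S) e = of_int (m - n) * L (m + n) S e"
proof (cases "m = n")
  case False
  then have "- 1 \<le> m + n" using assms by auto
  from defect_eq_0[OF False assms(1,2) this assms(3), of e] show ?thesis by (simp add: defect_def)
qed simp

end


section \<open>Weights, the Jacobian ideal and the residue pairing\<close>

lemma lookup_const_poly_mult: "coeff_at (const_poly c * p) e = c * coeff_at p e"
proof -
  have "coeff_at (Poly_Mapping.map ((*) c) p) e = c * coeff_at p e"
    by (simp add: Poly_Mapping.map.rep_eq when_def)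
  then show ?thesis by (simp add: mult_map_scale_conv_mult)
qed

lemma lookup_sum_single:
  "finite A \<Longrightarrow> coeff_at (\<Sum>e\<in>A. Poly_Mapping.single e (c e)) e = (if e \<in> A then c e else 0)"
  by (simp add: lookup_sum lookup_single when_def)

lemma quasi_homogeneous_mult:
  assumes "quasi_homogeneous q v p" "quasi_homogeneous q w p'"
  shows "quasi_homogeneous q (v + w) (p * p')"
  unfolding quasi_homogeneous_def
proof
  fix e assume "e \<in> Poly_Mapping.keys (p * p')"
  then obtain a b where "e = a + b" "a \<in> Poly_Mapping.keys p" "b \<in> Poly_Mapping.keys p'"
    using keys_mult[of p p'] by blast
  then show "(\<Sum>i\<in>UNIV. real (expo e i) * q i) = v + w"
    using assms by (simp add: quasi_homogeneous_def lookup_add distrib_right sum.distrib)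
qed

lemma quasi_homogeneous_zero: "quasi_homogeneous q w 0"
  by (simp add: quasi_homogeneous_def)

lemma quasi_homogeneous_add:
  "quasi_homogeneous q w p \<Longrightarrow> quasi_homogeneous q w p' \<Longrightarrow> quasi_homogeneous q w (p + p')"
  using Poly_Mapping.keys_add[of p p'] by (auto simp: quasi_homogeneous_def)

lemma quasi_homogeneous_uminus: "quasi_homogeneous q w p \<Longrightarrow> quasi_homogeneous q w (- p)"
  by (simp add: quasi_homogeneous_def in_keys_iff)

lemma quasi_homogeneous_sum:
  "(\<And>s. s \<in> A \<Longrightarrow> quasi_homogeneous q w (p s)) \<Longrightarrow> quasi_homogeneous q w (sum p A)"
  by (induction A rule: infinite_finite_induct)
    (auto intro: quasi_homogeneous_zero quasi_homogeneous_add)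

lemma quasi_homogeneous_prod:
  "(\<And>i. i \<in> A \<Longrightarrow> quasi_homogeneous q (w i) (p i)) \<Longrightarrow> finite A \<Longrightarrow>
    quasi_homogeneous q (sum w A) (prod p A)"
proof (induction A rule: infinite_finite_induct)
  case empty
  show ?case by (simp add: quasi_homogeneous_def)
qed (auto intro: quasi_homogeneous_mult)

text \<open>A permutation only reorders the v j, so all terms of the determinant have the same
  weight.\<close>

lemma quasi_homogeneous_det:
  assumes "finite F" "\<And>i j. i \<in> F \<Longrightarrow> j \<in> F \<Longrightarrow> quasi_homogeneous q (u i - v j) (c i j)"
  shows "quasi_homogeneous q (\<Sum>i\<in>F. u i - v i) (\<Sum>s | s permutes F. of_int (sign s) * (\<Prod>i\<in>F. c i (s i)))"
proof (rule quasi_homogeneous_sum)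
  fix s assume "s \<in> {s. s permutes F}"
  then have s: "s permutes F" by simp
  have "(\<Sum>i\<in>F. u i - v (s i)) = (\<Sum>i\<in>F. u i - v i)"
    using sum.permute[OF s, of v] by (simp add: sum_subtractf comp_def)
  moreover have "quasi_homogeneous q (\<Sum>i\<in>F. u i - v (s i)) (\<Prod>i\<in>F. c i (s i))"
    using assms permutes_in_image[OF s] by (intro quasi_homogeneous_prod) auto
  ultimately show "quasi_homogeneous q (\<Sum>i\<in>F. u i - v i) (of_int (sign s) * (\<Prod>i\<in>F. c i (s i)))"
    by (auto simp: sign_def intro: quasi_homogeneous_uminus)
qed

text \<open>The determinant has weight sum (M_i q_i - (1 - q_i)) and the monomial that is read has
  weight sum (M_i - 1) q_i. The exponents M cancel in the difference, which is the weight of the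
  Hessian.\<close>

lemma grothendieck_residue_weight:
  fixes W :: "'n::finite mpoly"
  assumes "grothendieck_residue W F p \<noteq> 0" "quasi_homogeneous (weights W) w p"
  shows "w = (\<Sum>i\<in>F. 1 - 2 * weights W i)"
proof -
  define Mc where "Mc = (SOME Mc. residue_presentation W F (fst Mc) (snd Mc))"
  obtain M c where Mc: "Mc = (M, c)" by (cases Mc)
  have ex: "\<exists>M c. residue_presentation W F M c"
    using assms(1) by (auto simp: grothendieck_residue_def split: if_splits)
  then have "\<exists>Mc. residue_presentation W F (fst Mc) (snd Mc)" by auto
  then have "residue_presentation W F (fst Mc) (snd Mc)" unfolding Mc_def by (rule someI_ex)
  then have rp: "residue_presentation W F M c" by (simp add: Mc)
  let ?q = "weights W"
  let ?D = "\<Sum>s | s permutes F. of_int (sign s) * (\<Prod>i\<in>F. c i (s i))"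
  let ?e = "\<Sum>i\<in>F. Poly_Mapping.single i (M i - 1)"
  have "quasi_homogeneous ?q (\<Sum>i\<in>F. real (M i) * ?q i - (1 - ?q i)) ?D"
    using rp by (intro quasi_homogeneous_det) (auto simp: residue_presentation_def)
  then have D: "quasi_homogeneous ?q ((\<Sum>i\<in>F. real (M i) * ?q i - (1 - ?q i)) + w) (?D * p)"
    using assms(2) by (rule quasi_homogeneous_mult)
  have "coeff_at (?D * p) ?e \<noteq> 0"
    using assms(1) ex Mc unfolding grothendieck_residue_def Mc_def by auto
  then have "?e \<in> Poly_Mapping.keys (?D * p)" by (simp add: in_keys_iff)
  with D have "(\<Sum>i\<in>UNIV. real (expo ?e i) * ?q i) = (\<Sum>i\<in>F. real (M i) * ?q i - (1 - ?q i)) + w"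
    by (auto simp: quasi_homogeneous_def)
  moreover have "(\<Sum>i\<in>UNIV. real (expo ?e i) * ?q i) = (\<Sum>i\<in>F. (real (M i) - 1) * ?q i)"
  proof -
    have "expo ?e i = (if i \<in> F then M i - 1 else 0)" for i
      by (simp add: lookup_sum lookup_single when_def)
    then have "(\<Sum>i\<in>UNIV. real (expo ?e i) * ?q i) = (\<Sum>i\<in>UNIV. if i \<in> F then real (M i - 1) * ?q i else 0)"
      by (intro sum.cong) auto
    also have "\<dots> = (\<Sum>i\<in>F. real (M i - 1) * ?q i)" by (simp add: sum.If_cases)
    also have "\<dots> = (\<Sum>i\<in>F. (real (M i) - 1) * ?q i)"
      using rp by (intro sum.cong refl) (auto simp: residue_presentation_def of_nat_diff)
    finally show ?thesis .
  qed
  ultimately show ?thesis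
    by (simp add: sum.distrib sum_subtractf left_diff_distrib flip: sum_distrib_left)
qed

section \<open>Weights, phases and the action of J\<close>

lemma weight_system_weights: "nondegenerate W \<Longrightarrow> weight_system W (weights W)"
  unfolding nondegenerate_def weights_def by (elim conjE) (rule theI'[where P = "weight_system W"])

lemma theta_inverse:
  assumes "g * h = (1 :: complex ^ 'n)"
  shows "theta g i + theta h i = (if theta g i = 0 then 0 else 1)"
    and "theta h i = 0 \<longleftrightarrow> theta g i = 0"
proof -
  have "g $ i * h $ i = 1" using assms by (metis one_index vector_mult_component)
  then have h: "h $ i = inverse (g $ i)" by (metis inverse_unique)
  show "theta h i = 0 \<longleftrightarrow> theta g i = 0"
    by (simp add: theta_def h Arg2pi_inverse_eq_0)
  show "theta g i + theta h i = (if theta g i = 0 then 0 else 1)"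
  \<comment> \<open>A real entry has phase 0 or 1/2 and shares it with its inverse; in the other
    case inversion reflects the argument.\<close>
  proof (cases "g $ i \<in> \<real>")
    case True
    then show ?thesis by (simp add: theta_def h Arg2pi_inverse Arg2pi_real)
  next
    case False
    then have "Arg2pi (g $ i) \<noteq> 0" by (simp add: Arg2pi_eq_0)
    moreover have "Arg2pi (h $ i) = 2 * pi - Arg2pi (g $ i)"
      using False by (simp add: h Arg2pi_inverse)
    ultimately show ?thesis by (simp add: theta_def diff_divide_distrib)
  qed
qed

lemma fixed_vars_inverse: "g * h = (1 :: complex ^ 'n) \<Longrightarrow> fixed_vars h = fixed_vars g"
  using theta_inverse(2) by (auto simp: fixed_vars_def)

text \<open>Weights lie in (0, 1/2], inside the range [0, 1) of phases, so the exponential loses no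
  integer part.\<close>

lemma theta_exponential_element:
  assumes "nondegenerate W"
  shows "theta (exponential_element W) i = weights W i"
proof -
  have q: "0 < weights W i" "weights W i \<le> 1 / 2"
    using weight_system_weights[OF assms] by (auto simp: weight_system_def)
  have "Arg2pi (exponential_element W $ i) = 2 * pi * weights W i"
    using q by (intro Arg2pi_unique[of 1]) (auto simp: exponential_element_def mult_ac)
  then show ?thesis by (simp add: theta_def)
qed

text \<open>A nonzero polynomial has a monomial, and this is what makes the description in
  \<open>wt\<close> single out a value.\<close>

lemma wt_eq:
  assumes "p \<noteq> 0" "p \<in> polys_in (fixed_vars g)" "quasi_homogeneous (weights W) w p"
  shows "wt W g p = w + (\<Sum>i\<in>fixed_vars g. weights W i)"
proof -
  have key: "(\<Sum>i\<in>fixed_vars g. (real (expo e i) + 1) * weights W i) = w + (\<Sum>i\<in>fixed_vars g. weights W i)"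
    if "e \<in> Poly_Mapping.keys p" for e
  proof -
    have "Poly_Mapping.keys e \<subseteq> fixed_vars g"
      using assms(2) that by (simp add: polys_in_def)
    then have "expo e i = 0" if "i \<notin> fixed_vars g" for i
      using that by (metis in_keys_iff subsetD)
    then have "(\<Sum>i\<in>fixed_vars g. real (expo e i) * weights W i) = (\<Sum>i\<in>UNIV. real (expo e i) * weights W i)"
      by (intro sum.mono_neutral_left) auto
    then show ?thesis
      using assms(3) that by (simp add: quasi_homogeneous_def distrib_right sum.distrib)
  qed
  obtain e where "e \<in> Poly_Mapping.keys p" using assms(1) by (metis all_not_in_conv keys_eq_empty)
  then show ?thesis unfolding wt_def using key by (intro the_equality) auto
qed

text \<open>J turns each monomial by its weight and the form dx by the sum of q_i over F, so a
  homogeneous form is an eigenvector.\<close>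

lemma act_exponential_element:
  assumes "quasi_homogeneous (weights W) w p"
  shows "act_form (exponential_element W) F p =
    const_poly (exp (2 * of_real pi * \<i> * of_real (w + (\<Sum>i\<in>F. weights W i)))) * p"
proof -
  let ?z = "\<lambda>x. exp (2 * of_real pi * \<i> * complex_of_real x)"
  have J: "exponential_element W $ i = ?z (weights W i)" for i
    by (simp add: exponential_element_def)
  have sum: "(\<Prod>i\<in>A. ?z (x i)) = ?z (sum x A)" if "finite A" for A x
    using that by (simp add: exp_sum sum_distrib_left)
  have "rescale (exponential_element W) p = const_poly (?z w) * p"
  proof (rule poly_mapping_eqI)
    fix e
    have "(\<Prod>i\<in>UNIV. exponential_element W $ i ^ expo e i) = ?z w" if "e \<in> Poly_Mapping.keys p"
    proof -
      have "(\<Prod>i\<in>UNIV. exponential_element W $ i ^ expo e i) = (\<Prod>i\<in>UNIV. ?z (real (expo e i) * weights W i))"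
        by (intro prod.cong) (simp_all add: J mult_ac flip: exp_of_nat_mult)
      also have "\<dots> = ?z (\<Sum>i\<in>UNIV. real (expo e i) * weights W i)" by (rule sum) simp
      also have "(\<Sum>i\<in>UNIV. real (expo e i) * weights W i) = w"
        using assms that by (simp add: quasi_homogeneous_def)
      finally show ?thesis .
    qed
    then show "coeff_at (rescale (exponential_element W) p) e = coeff_at (const_poly (?z w) * p) e"
      unfolding rescale_def
      by (simp add: lookup_sum_single lookup_const_poly_mult in_keys_iff)
  qed
  then have "act_form (exponential_element W) F p =
      const_poly (?z (\<Sum>i\<in>F. weights W i)) * (const_poly (?z w) * p)"
    by (simp only: act_form_def J sum[OF finite])
  also have "\<dots> = const_poly (?z (\<Sum>i\<in>F. weights W i) * ?z w) * p"
    by (simp add: mult_single flip: mult.assoc)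
  also have "?z (\<Sum>i\<in>F. weights W i) * ?z w = ?z (w + (\<Sum>i\<in>F. weights W i))"
    by (simp add: distrib_left exp_add mult.commute)
  finally show ?thesis .
qed

section \<open>The Jacobian ideal and integrality of weights\<close>

lemma polys_in_const_mult:
  assumes "p \<in> polys_in F" shows "const_poly c * p \<in> polys_in F"
proof -
  have "Poly_Mapping.keys (const_poly c * p) \<subseteq> Poly_Mapping.keys p"
  proof
    fix e assume "e \<in> Poly_Mapping.keys (const_poly c * p)"
    then have "c * coeff_at p e \<noteq> 0"
      unfolding lookup_const_poly_mult[symmetric] by (rule iffD1[OF in_keys_iff])
    then have "coeff_at p e \<noteq> 0" by (rule contrapos_nn) (simp only: mult_zero_right)
    then show "e \<in> Poly_Mapping.keys p" by (rule iffD2[OF in_keys_iff])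
  qed
  with assms show ?thesis by (auto simp: polys_in_def)
qed

lemma polys_in_diff: "p \<in> polys_in F \<Longrightarrow> p' \<in> polys_in F \<Longrightarrow> p - p' \<in> polys_in F"
  unfolding polys_in_def
proof (intro CollectI ballI)
  fix e assume *: "p \<in> {p. \<forall>e\<in>Poly_Mapping.keys p. Poly_Mapping.keys e \<subseteq> F}"
    "p' \<in> {p. \<forall>e\<in>Poly_Mapping.keys p. Poly_Mapping.keys e \<subseteq> F}" "e \<in> Poly_Mapping.keys (p - p')"
  then have "e \<in> Poly_Mapping.keys p \<or> e \<in> Poly_Mapping.keys p'"
    by (auto simp: in_keys_iff[of e] lookup_minus)
  with * show "Poly_Mapping.keys e \<subseteq> F" by blast
qed

lemma zero_in_jacobian_ideal: "0 \<in> jacobian_ideal W F"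
  unfolding jacobian_ideal_def by (rule CollectI, rule exI[of _ "\<lambda>_. 0"]) (simp add: polys_in_def)

lemma jacobian_ideal_diff:
  assumes "p \<in> jacobian_ideal W F" "p' \<in> jacobian_ideal W F"
  shows "p - p' \<in> jacobian_ideal W F"
proof -
  obtain h h' where h: "p = (\<Sum>i\<in>F. h i * partial_deriv i (restrict_poly F W))" "\<forall>i\<in>F. h i \<in> polys_in F"
    "p' = (\<Sum>i\<in>F. h' i * partial_deriv i (restrict_poly F W))" "\<forall>i\<in>F. h' i \<in> polys_in F"
    using assms by (auto simp: jacobian_ideal_def)
  then show ?thesis unfolding jacobian_ideal_def
    by (intro CollectI exI[of _ "\<lambda>i. h i - h' i"]) (simp add: left_diff_distrib sum_subtractf polys_in_diff)
qed

lemma jacobian_ideal_const_mult: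
  assumes "p \<in> jacobian_ideal W F" shows "const_poly c * p \<in> jacobian_ideal W F"
proof -
  obtain h where h: "p = (\<Sum>i\<in>F. h i * partial_deriv i (restrict_poly F W))" "\<forall>i\<in>F. h i \<in> polys_in F"
    using assms by (auto simp: jacobian_ideal_def)
  then show ?thesis unfolding jacobian_ideal_def
    by (intro CollectI exI[of _ "\<lambda>i. const_poly c * h i"])
      (simp add: sum_distrib_left mult.assoc polys_in_const_mult)
qed

lemma jac_class_eq_zero:
  assumes "p \<in> jacobian_ideal W F"
  shows "jac_class W F p = jac_class W F 0"
proof -
  have "p' - p \<in> jacobian_ideal W F \<longleftrightarrow> p' \<in> jacobian_ideal W F" for p'
  proof
    assume "p' - p \<in> jacobian_ideal W F"
    from jacobian_ideal_diff[OF this jacobian_ideal_diff[OF zero_in_jacobian_ideal assms]]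
    show "p' \<in> jacobian_ideal W F" by simp
  qed (rule jacobian_ideal_diff[OF _ assms])
  then show ?thesis by (simp add: jac_class_def)
qed

text \<open>Otherwise the zero vector and the b-th unit vector would both be coordinates of the same
  class.\<close>

lemma basis_notin_jacobian_ideal:
  assumes "homogeneous_basis W G r gam f" "b < r"
  shows "f b \<notin> jacobian_ideal W (fixed_vars (gam b))"
proof
  let ?F = "fixed_vars (gam b)"
  assume "f b \<in> jacobian_ideal W ?F"
  then have zero: "jac_class W ?F (f b) = jac_class W ?F 0" by (rule jac_class_eq_zero)
  let ?P = "\<lambda>c :: nat \<Rightarrow> complex. (\<forall>a. c a \<noteq> 0 \<longrightarrow> a < r \<and> gam a = gam b) \<and>
    jac_class W ?F (\<Sum>a<r. const_poly (c a) * f a) = jac_class W ?F (f b)"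
  have "gam b \<in> G" "jac_class W ?F (f b) \<in> sector W G (gam b)"
    using assms by (auto simp: homogeneous_basis_def)
  then have unique: "\<exists>!c. ?P c" using assms(1) unfolding homogeneous_basis_def by blast
  then have unique: "Uniq ?P" by (simp only: ex1_iff_ex_Uniq)
  have 0: "?P (\<lambda>_. 0)" using zero by simp
  have 1: "?P (\<lambda>a. if a = b then 1 else 0)"
  proof -
    have "(\<Sum>a<r. const_poly (if a = b then 1 else 0) * f a) = (\<Sum>a<r. if a = b then f b else 0)"
      by (intro sum.cong) auto
    then show ?thesis using assms(2) by simp
  qed
  have "(\<lambda>_. 0) = (\<lambda>a. if a = b then 1 else 0 :: complex)"
    by (rule Uniq_D[of ?P, OF unique]) (fact 0, fact 1)
  then show False by (metis zero_neq_one)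
qed

lemma basis_nonzero: "homogeneous_basis W G r gam f \<Longrightarrow> b < r \<Longrightarrow> f b \<noteq> 0"
  using basis_notin_jacobian_ideal zero_in_jacobian_ideal by metis

lemma basis_weight:
  assumes "homogeneous_basis W G r gam f" "b < r"
  shows "quasi_homogeneous (weights W) (wt W (gam b) (f b) - (\<Sum>i\<in>fixed_vars (gam b). weights W i)) (f b)"
proof -
  obtain w where "quasi_homogeneous (weights W) w (f b)" "f b \<in> polys_in (fixed_vars (gam b))"
    using assms by (auto simp: homogeneous_basis_def)
  with wt_eq[OF basis_nonzero[OF assms]] show ?thesis by simp
qed

lemma rescale_lookup: "coeff_at (rescale l p) e = coeff_at p e * (\<Prod>i\<in>UNIV. l $ i ^ expo e i)"
  by (simp add: rescale_def lookup_sum_single in_keys_iff)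

lemma rescale_diff: "rescale l (p - p') = rescale l p - rescale l p'"
  by (rule poly_mapping_eqI) (simp add: rescale_lookup lookup_minus left_diff_distrib)

lemma rescale_sum: "rescale l (sum p A) = (\<Sum>i\<in>A. rescale l (p i))"
  by (rule poly_mapping_eqI) (simp add: rescale_lookup lookup_sum sum_distrib_right)

lemma rescale_single:
  "rescale l (Poly_Mapping.single e c) = Poly_Mapping.single e (c * (\<Prod>i\<in>UNIV. l $ i ^ expo e i))"
  by (rule poly_mapping_eqI) (auto simp: rescale_lookup lookup_single when_def)

lemma sum_of_singles: "(\<Sum>e\<in>Poly_Mapping.keys p. Poly_Mapping.single e (coeff_at p e)) = p"
  by (rule poly_mapping_eqI) (simp add: lookup_sum_single in_keys_iff)

lemma rescale_mult: "rescale l (p * p') = rescale l p * rescale l p'"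
proof -
  have "rescale l (p * p') = rescale l (\<Sum>a\<in>Poly_Mapping.keys p. \<Sum>b\<in>Poly_Mapping.keys p'.
    Poly_Mapping.single (a + b) (coeff_at p a * coeff_at p' b))"
    by (subst (1 2) sum_of_singles[symmetric]) (simp add: sum_product mult_single)
  also have "\<dots> = rescale l p * rescale l p'"
    unfolding rescale_sum rescale_single
    by (simp add: rescale_def sum_product mult_single lookup_add power_add prod.distrib mult_ac)
  finally show ?thesis .
qed

lemma quasi_homogeneous_partial_deriv:
  assumes "quasi_homogeneous q w p"
  shows "quasi_homogeneous q (w - q i) (partial_deriv i p)"
  unfolding partial_deriv_def
proof (rule quasi_homogeneous_sum)
  fix e assume e: "e \<in> Poly_Mapping.keys p"
  show "quasi_homogeneous q (w - q i)
    (Poly_Mapping.single (e - Poly_Mapping.single i 1) (of_nat (expo e i) * coeff_at p e))"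
  proof (cases "expo e i = 0")
    case False
    have "real (expo (e - Poly_Mapping.single i 1) j) * q j = real (expo e j) * q j - (if j = i then q i else 0)" for j
      using False by (auto simp: lookup_minus lookup_single when_def of_nat_diff algebra_simps)
    then show ?thesis
      using assms e by (simp add: quasi_homogeneous_def sum_subtractf)
  qed (simp add: quasi_homogeneous_zero)
qed

lemma quasi_homogeneous_restrict: "quasi_homogeneous q w p \<Longrightarrow> quasi_homogeneous q w (restrict_poly F p)"
  unfolding restrict_poly_def by (intro quasi_homogeneous_sum) (auto simp: quasi_homogeneous_def)

lemma rescale_exponential_element:
  "quasi_homogeneous (weights W) w p \<Longrightarrow> rescale (exponential_element W) p =
    const_poly (exp (2 * of_real pi * \<i> * of_real w)) * p"
  using act_exponential_element[of W w p "{}"] by (simp add: act_form_def)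

text \<open>The partial derivatives of a homogeneous polynomial are eigenvectors of J, and their
  eigenvalues are absorbed into the cofactors.\<close>

lemma jacobian_ideal_act:
  assumes "nondegenerate W" "p \<in> jacobian_ideal W F"
  shows "act_form (exponential_element W) F p \<in> jacobian_ideal W F"
proof -
  let ?J = "exponential_element W"
  obtain h where h: "p = (\<Sum>i\<in>F. h i * partial_deriv i (restrict_poly F W))" "\<forall>i\<in>F. h i \<in> polys_in F"
    using assms by (auto simp: jacobian_ideal_def)
  have "quasi_homogeneous (weights W) 1 W"
    using weight_system_weights[OF assms(1)] by (simp add: weight_system_def)
  then have "quasi_homogeneous (weights W) (1 - weights W i) (partial_deriv i (restrict_poly F W))" for i
    by (intro quasi_homogeneous_partial_deriv quasi_homogeneous_restrict)
  note d = rescale_exponential_element[OF this]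
  have "rescale ?J (h i) \<in> polys_in F" if "i \<in> F" for i
  proof -
    have "Poly_Mapping.keys (rescale ?J (h i)) \<subseteq> Poly_Mapping.keys (h i)"
      by (rule subsetI) (simp add: in_keys_iff rescale_lookup)
    with h(2) that show ?thesis by (auto simp: polys_in_def)
  qed
  then have "rescale ?J p \<in> jacobian_ideal W F"
    unfolding jacobian_ideal_def h(1) rescale_sum rescale_mult d
    by (intro CollectI exI[of _ "\<lambda>i. const_poly (exp (2 * of_real pi * \<i> * of_real (1 - weights W i)))
          * rescale ?J (h i)"] conjI ballI polys_in_const_mult) (simp_all only: mult_ac)
  then show ?thesis unfolding act_form_def by (rule jacobian_ideal_const_mult)
qed

text \<open>J multiplies the form by z = exp(2 pi i wt). Since the class is fixed, (1 - z) f_b lies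
  in the Jacobian ideal, and for z different from 1 so would f_b.\<close>

lemma basis_weight_integral:
  assumes LG: "admissible_LG_pair W G" and basis: "homogeneous_basis W G r gam f" and b: "b < r"
  shows "exp (2 * of_real pi * \<i> * of_real (wt W (gam b) (f b))) = (1 :: complex)"
proof (rule ccontr)
  let ?F = "fixed_vars (gam b)" and ?J = "exponential_element W"
  define z where "z = exp (2 * of_real pi * \<i> * complex_of_real (wt W (gam b) (f b)))"
  assume "exp (2 * of_real pi * \<i> * of_real (wt W (gam b) (f b))) \<noteq> (1 :: complex)"
  then have z: "z \<noteq> 1" by (simp add: z_def)
  have J: "?J \<in> G" and nd: "nondegenerate W" using LG by (auto simp: admissible_LG_pair_def)
  have f: "f b \<in> polys_in ?F" "jac_class W ?F (f b) \<in> sector W G (gam b)"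
    using basis b by (auto simp: homogeneous_basis_def)
  \<comment> \<open>The sector only promises some representative p with a fixed class; stability of
    the ideal under J carries this over to f_b.\<close>
  then obtain p where p: "p \<in> polys_in ?F" "jac_class W ?F (f b) = jac_class W ?F p"
    "jac_class W ?F (act_form ?J ?F p) = jac_class W ?F p"
    using J by (auto simp: sector_def)
  have "p - p \<in> jacobian_ideal W ?F" using zero_in_jacobian_ideal by simp
  then have 1: "p - f b \<in> jacobian_ideal W ?F" "p - act_form ?J ?F p \<in> jacobian_ideal W ?F"
    using p unfolding jac_class_def by blast+
  have act: "act_form ?J ?F (f b) = const_poly z * f b"
    using act_exponential_element[OF basis_weight[OF basis b], of ?F] by (simp add: z_def)
  have "act_form ?J ?F (p - f b) = act_form ?J ?F p - const_poly z * f b"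
    unfolding act[symmetric] by (simp add: act_form_def rescale_diff right_diff_distrib)
  then have "act_form ?J ?F p - const_poly z * f b \<in> jacobian_ideal W ?F"
    using jacobian_ideal_act[OF nd 1(1)] by simp
  moreover have "act_form ?J ?F p - f b \<in> jacobian_ideal W ?F"
    using jacobian_ideal_diff[OF 1(1,2)] by simp
  ultimately have "(act_form ?J ?F p - const_poly z * f b) - (act_form ?J ?F p - f b) \<in> jacobian_ideal W ?F"
    by (rule jacobian_ideal_diff)
  then have "const_poly (1 / (1 - z)) * (f b - const_poly z * f b) \<in> jacobian_ideal W ?F"
    by (intro jacobian_ideal_const_mult) simp
  also have "const_poly (1 / (1 - z)) * (f b - const_poly z * f b) = f b"
  proof (rule poly_mapping_eqI)
    fix e
    have "1 - z \<noteq> 0" using z by simp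
    then have "1 / (1 - z) * (x - z * x) = x" for x by (simp add: field_simps)
    then show "coeff_at (const_poly (1 / (1 - z)) * (f b - const_poly z * f b)) e = coeff_at (f b) e"
      by (simp only: lookup_const_poly_mult lookup_minus)
  qed
  finally show False using basis_notin_jacobian_ideal[OF basis b] by simp
qed

text \<open>In the residue weight each fixed variable counts 1 - 2 q_i, and the two forms dx
  contribute the missing 2 q_i.\<close>

lemma eta_nonzero_weights:
  assumes basis: "homogeneous_basis W G r gam f" and "a < r" "b < r" and inv: "gam a * gam b = 1"
    and res: "grothendieck_residue W (fixed_vars (gam a)) (f a * f b) \<noteq> 0"
  shows "wt W (gam a) (f a) + wt W (gam b) (f b) = real (fix_dim (gam a))"
proof -
  have F: "fixed_vars (gam b) = fixed_vars (gam a)" by (rule fixed_vars_inverse[OF inv])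
  from grothendieck_residue_weight[OF res quasi_homogeneous_mult[OF basis_weight[OF basis \<open>a < r\<close>]
        basis_weight[OF basis \<open>b < r\<close>]]]
  show ?thesis by (simp add: F fix_dim_def sum_subtractf flip: sum_distrib_left)
qed

text \<open>The phases of inverse elements add to 1 off the fixed locus, so the two shifts
  \<open>iota\<close> add to c_W - N, while the weights of the forms add to N.\<close>

lemma eta_mu_plus:
  assumes basis: "homogeneous_basis W G r gam f" and "a < r" "b < r" and "eta W gam f a b \<noteq> 0"
  shows "mu_plus W (gam a) (f a) + mu_plus W (gam b) (f b) = 0"
proof -
  have inv: "gam a * gam b = 1" and res: "grothendieck_residue W (fixed_vars (gam a)) (f a * f b) \<noteq> 0"
    using assms(4) by (auto simp: eta_def split: if_splits)
  have "iota W (gam a) + iota W (gam b) =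
    (\<Sum>i\<in>UNIV. (theta (gam a) i + theta (gam b) i) - 2 * weights W i)"
    by (simp add: iota_def algebra_simps flip: sum.distrib)
  also have "\<dots> = (\<Sum>i\<in>UNIV. if theta (gam a) i = 0 then 0 else 1) - 2 * sum (weights W) UNIV"
    by (simp add: theta_inverse(1)[OF inv] sum_subtractf sum_distrib_left)
  also have "(\<Sum>i\<in>UNIV. if theta (gam a) i = 0 then 0 else 1 :: real) =
    (\<Sum>i\<in>UNIV. 1 - (if i \<in> fixed_vars (gam a) then 1 else 0))"
    by (intro sum.cong) (auto simp: fixed_vars_def)
  also have "\<dots> = (\<Sum>i\<in>(UNIV :: 'a set). 1) - real (fix_dim (gam a))"
    unfolding sum_subtractf by (simp add: fix_dim_def sum.If_cases)
  finally show ?thesis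
    using eta_nonzero_weights[OF basis assms(2,3) inv res]
    by (simp add: mu_plus_def central_charge_def sum_subtractf sum_distrib_left)
qed

lemma eta_fix_dim: "eta W gam f a b \<noteq> 0 \<Longrightarrow> fix_dim (gam a) = fix_dim (gam b)"
  using fixed_vars_inverse[of "gam a" "gam b"] by (auto simp: eta_def fix_dim_def split: if_splits)

lemma eta_graded_symmetric:
  assumes LG: "admissible_LG_pair W G" and basis: "homogeneous_basis W G r gam f" and ab: "a < r" "b < r"
  shows "eta W gam f b a = (if odd (fix_dim (gam a)) then - 1 else 1) * eta W gam f a b"
proof (cases "gam a * gam b = 1 \<and> grothendieck_residue W (fixed_vars (gam a)) (f a * f b) \<noteq> 0")
  case True
  then have inv: "gam a * gam b = 1" "gam b * gam a = 1" by (auto simp: mult.commute)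
  have F: "fixed_vars (gam b) = fixed_vars (gam a)" by (rule fixed_vars_inverse[OF inv(1)])
  have sign: "exp (of_real pi * \<i> * complex_of_real (wt W (gam a) (f a))) =
    - exp (of_real pi * \<i> * complex_of_real (wt W (gam b) (f b)))" if "odd (fix_dim (gam a))"
  proof -
    let ?w = "complex_of_real (wt W (gam b) (f b))"
    have wt: "wt W (gam a) (f a) = real (fix_dim (gam a)) - wt W (gam b) (f b)"
      using eta_nonzero_weights[OF basis ab inv(1)] True by simp
    \<comment> \<open>Writing -w as w - 2 w brings in exp(2 pi i w) = 1, so that only the sign
      (-1)^N separates the two factors.\<close>
    have "exp (of_real pi * \<i> * complex_of_real (wt W (gam a) (f a))) =
      exp (of_real pi * \<i> * of_nat (fix_dim (gam a)) + of_real pi * \<i> * ?w - 2 * of_real pi * \<i> * ?w)"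
      unfolding wt by (simp add: algebra_simps)
    also have "\<dots> = exp (of_real pi * \<i>) ^ fix_dim (gam a) * exp (of_real pi * \<i> * ?w)"
      unfolding exp_diff exp_add exp_of_nat2_mult basis_weight_integral[OF LG basis ab(2)] by simp
    finally show ?thesis using that by (simp add: mult.commute[of "of_real pi"])
  qed
  have fd: "fix_dim (gam b) = fix_dim (gam a)" by (simp add: fix_dim_def F)
  have comm: "f b * f a = f a * f b" by (rule mult.commute)
  show ?thesis using sign
    by (simp add: eta_def inv F fd comm)
next
  case False
  then show ?thesis
    using fixed_vars_inverse[of "gam a" "gam b"]
    by (auto simp: eta_def mult.commute[of "gam b"] mult.commute[of "f b"])
qed

text \<open>The phases of J are the weights, which are positive: no variable is fixed,
  \<open>iota\<close> vanishes and \<open>wt\<close> is an empty sum.\<close>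

lemma mu_plus_exponential_element:
  assumes "nondegenerate W"
  shows "fixed_vars (exponential_element W) = {}" "mu_plus W (exponential_element W) 1 = - central_charge W / 2"
proof -
  have "0 < weights W i" for i
    using weight_system_weights[OF assms] by (simp add: weight_system_def)
  then have "weights W i \<noteq> 0" for i by (metis less_irrefl)
  then show F: "fixed_vars (exponential_element W) = {}"
    by (simp add: fixed_vars_def theta_exponential_element[OF assms])
  have "wt W (exponential_element W) 1 = 0" by (simp add: wt_def F)
  then show "mu_plus W (exponential_element W) 1 = - central_charge W / 2"
    by (simp add: mu_plus_def iota_def theta_exponential_element[OF assms])
qed


section \<open>The Virasoro operators of an LG pair\<close>

context virasoro_data
begin

text \<open>The shift in the summand for t^0_1 is the linear term of L_k. It can be split off only
  after truncation, when the sum is finite.\<close>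

lemma Lb_unshifted:
  assumes "- 1 \<le> k"
  shows "Lb k S e = - vc k 0 1 * t_deriv od (0, nat (k + 1)) S e
    + Sum_any (\<lambda>m. if 0 \<le> int m + k
        then \<Sum>a<r. vc k a (int m) * t_mult r od (a, m) (t_deriv od (a, nat (int m + k)) S) e else 0)"
proof -
  obtain N where N: "bound e N" using bound_exists by blast
  then have N1: "1 \<le> N" by (simp add: bound_def)
  define c where "c m a = (if 0 \<le> int m + k then vc k a (int m) else 0)" for m a
  let ?t = "\<lambda>m a. t_mult r od (a, m) (t_deriv od (a, nat (int m + k)) S) e"
  have beyond: "?t m a = 0" if "N < m" for m a
    using N that by (auto simp: bound_def t_mult_def)
  have gen: "gen True (a, m) (gen False (a, nat (int m + k)) S) e =
    ?t m a - (if m = 1 \<and> a = 0 then t_deriv od (0, nat (k + 1)) S e else 0)" for a m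
  proof -
    have "gen False v S = t_deriv od v S" for v by (auto simp: gen_def)
    then show ?thesis by (auto simp: gen_def add.commute)
  qed
  have "Sum_any (\<lambda>m. if 0 \<le> int m + k then \<Sum>a<r. vc k a (int m) * ?t m a else 0) =
    (\<Sum>m\<le>N. if 0 \<le> int m + k then \<Sum>a<r. vc k a (int m) * ?t m a else 0)"
  proof (rule Sum_any.expand_superset)
    show "{m. (if 0 \<le> int m + k then \<Sum>a<r. vc k a (int m) * ?t m a else 0) \<noteq> 0} \<subseteq> {..N}"
    proof
      fix m assume "m \<in> {m. (if 0 \<le> int m + k then \<Sum>a<r. vc k a (int m) * ?t m a else 0) \<noteq> 0}"
      then show "m \<in> {..N}" by (cases "N < m") (auto simp: beyond split: if_splits)
    qed
  qed simp
  also have "\<dots> = (\<Sum>m\<le>N. \<Sum>a<r. c m a * ?t m a)"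
    by (intro sum.cong refl) (simp add: c_def)
  finally have unshifted: "Sum_any (\<lambda>m. if 0 \<le> int m + k then \<Sum>a<r. vc k a (int m) * ?t m a else 0) =
    (\<Sum>m\<le>N. \<Sum>a<r. c m a * ?t m a)" .
  have "Lb k S e = (\<Sum>m\<le>N. \<Sum>a<r. c m a * ?t m a
    - (if a = 0 then if m = 1 then vc k 0 1 * t_deriv od (0, nat (k + 1)) S e else 0 else 0))"
    unfolding Lb_eq_trunc[OF N] Lb_trunc_def sum.cartesian_product'
    using assms by (intro sum.cong refl) (auto simp: gen c_def right_diff_distrib)
  also have "\<dots> = (\<Sum>m\<le>N. \<Sum>a<r. c m a * ?t m a)
    - (\<Sum>m\<le>N. if m = 1 then vc k 0 1 * t_deriv od (0, nat (k + 1)) S e else 0)"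
    using r_pos by (simp add: sum_subtractf)
  also have "(\<Sum>m\<le>N. if m = 1 then vc k 0 1 * t_deriv od (0, nat (k + 1)) S e else 0) =
    vc k 0 1 * t_deriv od (0, nat (k + 1)) S e"
    using N1 by simp
  finally show ?thesis unfolding unshifted by simp
qed

lemma gen_eq: "gen False v = t_deriv od v" "gen True (a, 0) = t_mult r od (a, 0)"
  by (auto simp: gen_def fun_eq_iff)

text \<open>For k = 1 at level -1 the Pochhammer symbol has exactly the factors mu - 1/2 and mu +
  1/2.\<close>

lemma \<kappa>_eq: "\<kappa> = - fls_const (of_real (1 / 4 * (\<Sum>a<r. (if od a then - 1 else 1) * (mu a - 1 / 2) * (mu a + 1 / 2))))"
proof -
  have "super_sign od a a * vc 1 a (- 1) =
    fls_const (of_real ((if od a then - 1 else 1) * (mu a - 1 / 2) * (mu a + 1 / 2)))" for a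
  proof -
    have "pochhammer (mu a + of_int (- 1) + 1 / 2) (nat (1 + 1)) = (mu a - 1 / 2) * (mu a + 1 / 2)"
      by (simp add: numeral_2_eq_2 pochhammer_Suc)
    then have "vc 1 a (- 1) = fls_const (of_real ((mu a - 1 / 2) * (mu a + 1 / 2)))"
      by (simp only: vc_def)
    moreover have "super_sign od a a * fls_const (of_real x) =
      fls_const (of_real ((if od a then - 1 else 1) * x))" for x :: real
      by (simp add: super_sign_def)
    ultimately show ?thesis by (simp only: mult.assoc)
  qed
  then have "\<kappa> = - fls_const (of_real (\<Sum>a<r. (if od a then - 1 else 1) * (mu a - 1 / 2) * (mu a + 1 / 2))) / 4"
    by (simp add: \<kappa>_def fls_const_sum)
  also have "\<dots> = - fls_const (of_real (1 / 4 * (\<Sum>a<r. (if od a then - 1 else 1) * (mu a - 1 / 2) * (mu a + 1 / 2))))"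
    by (simp add: fls_const_divide_const flip: fls_const_numeral)
  finally show ?thesis .
qed

end

theorem proposition0p5:
  fixes W :: "'n::finite mpoly"
    and G :: "(complex ^ 'n) set"
    and r :: nat
    and gam :: "nat \<Rightarrow> complex ^ 'n"
    and f :: "nat \<Rightarrow> 'n mpoly"
    and E :: "nat \<Rightarrow> nat \<Rightarrow> complex"
    and m n :: int
    and S :: tseries
    and e :: "tvar \<Rightarrow>\<^sub>0 nat"
  assumes "admissible_LG_pair W G"
    and "homogeneous_basis W G r gam f"
    and "0 < r" and "gam 0 = exponential_element W" and "f 0 = 1"
    and "inverse_pairing r (eta W gam f) E"
    and "- 1 \<le> m" and "- 1 \<le> n"
    and "S \<in> super_series r (\<lambda>a. odd (fix_dim (gam a)))"
  shows "virasoro W r gam f E m (virasoro W r gam f E n S) e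
       - virasoro W r gam f E n (virasoro W r gam f E m S) e
       = of_int (m - n) * virasoro W r gam f E (m + n) S e"
\<comment> \<open>For m = n both sides vanish; this disposes of m = n = -1, the only pair whose sum
  is below -1.\<close>
proof (cases "m = n")
  case False
  define od where "od = (\<lambda>a. odd (fix_dim (gam a)))"
  define mu where "mu = (\<lambda>a. mu_plus W (gam a) (f a))"
  have nd: "nondegenerate W" using assms(1) by (simp add: admissible_LG_pair_def)
  interpret virasoro_data r od mu "eta W gam f" E
  proof
    show "0 < r" by fact
    show "\<not> od 0"
      using mu_plus_exponential_element(1)[OF nd] by (simp add: od_def assms(4) fix_dim_def)
    fix a b assume ab: "a < r" "b < r"
    show "eta W gam f a b \<noteq> 0 \<Longrightarrow> od a = od b"
      using eta_fix_dim[of W gam f a b] by (simp add: od_def)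
    show "eta W gam f a b \<noteq> 0 \<Longrightarrow> mu a + mu b = 0"
      using eta_mu_plus[OF assms(2) ab] by (simp add: mu_def)
    show "eta W gam f b a = (if od a then - 1 else 1) * eta W gam f a b"
      using eta_graded_symmetric[OF assms(1,2) ab] by (simp add: od_def)
  qed fact
  have mu0: "mu 0 + of_int 1 + 1 / 2 = (3 - central_charge W) / 2"
    using mu_plus_exponential_element(2)[OF nd] by (simp add: mu_def assms(4,5))
  have sign: "(- 1) ^ fix_dim (gam a) = (if od a then - 1 else 1 :: real)" for a
    by (simp add: od_def minus_one_power_iff)
  have virasoro: "virasoro W r gam f E k S = L k S" if k: "- 1 \<le> k" for k S
  proof
    fix e
    show "virasoro W r gam f E k S e = L k S e"
      unfolding virasoro_def Let_def L_def Lb_unshifted[OF k] Lc_def Lq_def gen_eq \<kappa>_eq vc_def mu0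
        \<epsilon>_def H_def K_def sign od_def[symmetric]
      by (simp add: mu_def cong: if_cong)
  qed
  have mn: "- 1 \<le> m + n" using False assms(7,8) by auto
  show ?thesis
    unfolding virasoro[OF assms(7)] virasoro[OF assms(8)] virasoro[OF mn]
    using assms(7-9) by (intro L_commutator) (simp_all add: od_def)
qed simp

end
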